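(* Let $V$ be a finite-dimensional real vector space with inner product $(\cdot,\cdot)$, let $\Phi\subset V$ be an irreducible (not necessarily reduced) root system with an ordering, with simple roots $\Pi=\{\alpha_1,\dots,\alpha_l\}$ and highest root $\psi$. Put $\triangle'=\{x\in V:(x,\alpha_i)\ge0\ (1\le i\le l),\ (x,\psi)=1\}$ and $d(\Phi)=\max_{x\in\triangle'}(x,x)^{1/2}$. Then: - $\Phi=\mathfrak{a}_l$ ($l\ge1$): $d(\Phi)=\frac{\sqrt2}{2}(\psi,\psi)^{-1/2}(l+1)^{1/2}$ if $l$ is odd, and $d(\Phi)=\frac{\sqrt2}{2}(\psi,\psi)^{-1/2}\big(l(l+2)\big)^{1/2}(l+1)^{-1/2}$ if $l$ is even; - $\Phi=\mathfrak{b}_l$ ($l\ge2$): $d(\Phi)=\sqrt2\,(\psi,\psi)^{-1/2}$ if $l\le3$, and $d(\Phi)=\frac{\sqrt2}{2}(\psi,\psi)^{-1/2}l^{1/2}$ if $l\ge4$; - $\Phi=\mathfrak{c}_l$ ($l\ge3$): $d(\Phi)=(\psi,\psi)^{-1/2}l^{1/2}$; - $\Phi=\mathfrak{d}_l$ ($l\ge4$): $d(\Phi)=\frac{\sqrt2}{2}(\psi,\psi)^{-1/2}l^{1/2}$; - $\Phi=\mathfrak{e}_6$: $d(\Phi)=\frac{2\sqrt6}{3}(\psi,\psi)^{-1/2}$; - $\Phi=\mathfrak{e}_7$: $d(\Phi)=\sqrt3\,(\psi,\psi)^{-1/2}$; - $\Phi=\mathfrak{e}_8$: $d(\Phi)=\sqrt2\,(\psi,\psi)^{-1/2}$;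 - $\Phi=\mathfrak{f}_4$: $d(\Phi)=\sqrt2\,(\psi,\psi)^{-1/2}$; - $\Phi=\mathfrak{g}_2$: $d(\Phi)=\frac{2\sqrt3}{3}(\psi,\psi)^{-1/2}$; - $\Phi=(\mathfrak{bc})_l$ ($l\ge1$): $d(\Phi)=(\psi,\psi)^{-1/2}l^{1/2}$.
   Context: A root system $\Phi\subset V$ is understood to be crystallographic, to span $V$ ($\dim V=l$), and to be taken with respect to the inner product $(\cdot,\cdot)$, which is invariant under its Weyl group. $\mathfrak{a}_l,\mathfrak{b}_l,\mathfrak{c}_l,\mathfrak{d}_l,\mathfrak{e}_6,\mathfrak{e}_7,\mathfrak{e}_8,\mathfrak{f}_4,\mathfrak{g}_2$ denote the irreducible reduced root systems of the corresponding Cartan types ($\mathfrak{b}_l$ has one short simple root, $\mathfrak{c}_l$ has one long simple root), and $(\mathfrak{bc})_l$ denotes the irreducible nonreduced root system of rank $l$, whose set of indivisible roots (roots $\alpha$ with $\tfrac12\alpha\notin\Phi$) is of type $\mathfrak{b}_l$ (of type $\mathfrak{a}_1$ if $l=1$). *)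

theory Defs
  imports "HOL-Analysis.Analysis"
begin

definition root_system :: "'a::euclidean_space set \<Rightarrow> bool" where
  "root_system \<Phi> \<longleftrightarrow>
     finite \<Phi> \<and> 0 \<notin> \<Phi> \<and> span \<Phi> = UNIV \<and>
     (\<forall>\<alpha>\<in>\<Phi>. \<forall>\<beta>\<in>\<Phi>. \<beta> - (2 * (\<beta> \<bullet> \<alpha>) / (\<alpha> \<bullet> \<alpha>)) *\<^sub>R \<alpha> \<in> \<Phi>) \<and>
     (\<forall>\<alpha>\<in>\<Phi>. \<forall>\<beta>\<in>\<Phi>. 2 * (\<beta> \<bullet> \<alpha>) / (\<alpha> \<bullet> \<alpha>) \<in> \<int>)"

definition irreducible_roots :: "'a::euclidean_space set \<Rightarrow> bool" where
  "irreducible_roots \<Phi> \<longleftrightarrow>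
     \<Phi> \<noteq> {} \<and>
     \<not> (\<exists>\<Phi>1 \<Phi>2. \<Phi>1 \<noteq> {} \<and> \<Phi>2 \<noteq> {} \<and> \<Phi>1 \<union> \<Phi>2 = \<Phi> \<and> \<Phi>1 \<inter> \<Phi>2 = {} \<and>
          (\<forall>\<alpha>\<in>\<Phi>1. \<forall>\<beta>\<in>\<Phi>2. \<alpha> \<bullet> \<beta> = 0))"

definition reduced_roots :: "'a::euclidean_space set \<Rightarrow> bool" where
  "reduced_roots \<Phi> \<longleftrightarrow> (\<forall>\<alpha>\<in>\<Phi>. \<forall>c::real. c *\<^sub>R \<alpha> \<in> \<Phi> \<longrightarrow> c = 1 \<or> c = -1)"

definition indivisible_roots :: "'a::euclidean_space set \<Rightarrow> 'a set" where
  "indivisible_roots \<Phi> = {\<alpha> \<in> \<Phi>. (1/2) *\<^sub>R \<alpha> \<notin> \<Phi>}"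

text \<open>An ordering is a total (strict) order on the ambient space that is compatible with its real
  vector space structure.\<close>

definition vector_ordering :: "('a::euclidean_space \<Rightarrow> 'a \<Rightarrow> bool) \<Rightarrow> bool" where
  "vector_ordering lt \<longleftrightarrow>
     (\<forall>x. \<not> lt x x) \<and>
     (\<forall>x y z. lt x y \<longrightarrow> lt y z \<longrightarrow> lt x z) \<and>
     (\<forall>x y. lt x y \<or> x = y \<or> lt y x) \<and>
     (\<forall>x y z. lt x y \<longrightarrow> lt (x + z) (y + z)) \<and>
     (\<forall>x y (c::real). lt x y \<longrightarrow> c > 0 \<longrightarrow> lt (c *\<^sub>R x) (c *\<^sub>R y))"

definition positive_roots :: "('a::euclidean_space \<Rightarrow> 'a \<Rightarrow> bool) \<Rightarrow> 'a set \<Rightarrow> 'a set" where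
  "positive_roots lt \<Phi> = {\<alpha> \<in> \<Phi>. lt 0 \<alpha>}"

definition simple_roots :: "('a::euclidean_space \<Rightarrow> 'a \<Rightarrow> bool) \<Rightarrow> 'a set \<Rightarrow> 'a set" where
  "simple_roots lt \<Phi> =
     {\<alpha> \<in> positive_roots lt \<Phi>.
        \<not> (\<exists>\<beta>\<in>positive_roots lt \<Phi>. \<exists>\<gamma>\<in>positive_roots lt \<Phi>. \<alpha> = \<beta> + \<gamma>)}"

definition highest_root :: "('a::euclidean_space \<Rightarrow> 'a \<Rightarrow> bool) \<Rightarrow> 'a set \<Rightarrow> 'a \<Rightarrow> bool" where
  "highest_root lt \<Phi> \<psi> \<longleftrightarrow> \<psi> \<in> \<Phi> \<and> (\<forall>\<beta>\<in>\<Phi>. \<beta> \<noteq> \<psi> \<longrightarrow> lt \<beta> \<psi>)"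

text \<open>Simple roots are numbered from 1 as in Bourbaki. The entry at \<open>i j\<close> of the Cartan
  matrix is \<open>2 (\<alpha>\<^sub>i, \<alpha>\<^sub>j) / (\<alpha>\<^sub>j, \<alpha>\<^sub>j)\<close>, so an entry below \<open>-1\<close> means that \<open>\<alpha>\<^sub>i\<close> is longer
  than \<open>\<alpha>\<^sub>j\<close>. Only \<open>Type_E l\<close> with \<open>l\<close> equal to 6, 7 or 8 is meant.\<close>

datatype cartan_type =
  Type_A nat | Type_B nat | Type_C nat | Type_D nat | Type_E nat | Type_F4 | Type_G2

fun cartan_rank :: "cartan_type \<Rightarrow> nat" where
  "cartan_rank (Type_A l) = l"
| "cartan_rank (Type_B l) = l"
| "cartan_rank (Type_C l) = l"
| "cartan_rank (Type_D l) = l"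
| "cartan_rank (Type_E l) = l"
| "cartan_rank Type_F4 = 4"
| "cartan_rank Type_G2 = 2"

definition path_entry :: "nat \<Rightarrow> nat \<Rightarrow> int" where
  "path_entry i j = (if i = j then 2 else if i = j + 1 \<or> j = i + 1 then -1 else 0)"

fun cartan_matrix :: "cartan_type \<Rightarrow> nat \<Rightarrow> nat \<Rightarrow> int" where
  "cartan_matrix (Type_A l) i j = path_entry i j"
| "cartan_matrix (Type_B l) i j = (if i + 1 = l \<and> j = l then -2 else path_entry i j)"
| "cartan_matrix (Type_C l) i j = (if i = l \<and> j + 1 = l then -2 else path_entry i j)"
| "cartan_matrix (Type_D l) i j =
     (if {i, j} = {l - 1, l} then 0
      else if {i, j} = {l - 2, l} then -1
      else path_entry i j)"
| "cartan_matrix (Type_E l) i j =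
     (if {i, j} = {1, 2} \<or> {i, j} = {2, 3} then 0
      else if {i, j} = {1, 3} \<or> {i, j} = {2, 4} then -1
      else path_entry i j)"
| "cartan_matrix Type_F4 i j = (if i = 2 \<and> j = 3 then -2 else path_entry i j)"
| "cartan_matrix Type_G2 i j = (if i = 2 \<and> j = 1 then -3 else path_entry i j)"

text \<open>The type is read off the simple roots of the given ordering; by conjugacy of simple systems
  under the Weyl group it does not depend on the ordering.\<close>

definition has_type ::
  "('a::euclidean_space \<Rightarrow> 'a \<Rightarrow> bool) \<Rightarrow> 'a set \<Rightarrow> cartan_type \<Rightarrow> bool" where
  "has_type lt \<Phi> X \<longleftrightarrow>
     reduced_roots \<Phi> \<and>
     (\<exists>\<alpha> :: nat \<Rightarrow> 'a.
        bij_betw \<alpha> {1..cartan_rank X} (simple_roots lt \<Phi>) \<and>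
        (\<forall>i\<in>{1..cartan_rank X}. \<forall>j\<in>{1..cartan_rank X}.
           2 * (\<alpha> i \<bullet> \<alpha> j) / (\<alpha> j \<bullet> \<alpha> j) = real_of_int (cartan_matrix X i j)))"

definition has_type_BC ::
  "('a::euclidean_space \<Rightarrow> 'a \<Rightarrow> bool) \<Rightarrow> 'a set \<Rightarrow> nat \<Rightarrow> bool" where
  "has_type_BC lt \<Phi> l \<longleftrightarrow>
     \<not> reduced_roots \<Phi> \<and>
     has_type lt (indivisible_roots \<Phi>) (if l = 1 then Type_A 1 else Type_B l)"

definition alcove_face ::
  "('a::euclidean_space \<Rightarrow> 'a \<Rightarrow> bool) \<Rightarrow> 'a set \<Rightarrow> 'a \<Rightarrow> 'a set" where
  "alcove_face lt \<Phi> \<psi> = {x. (\<forall>\<alpha>\<in>simple_roots lt \<Phi>. x \<bullet> \<alpha> \<ge> 0) \<and> x \<bullet> \<psi> = 1}"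

text \<open>\<open>GREATEST\<close> is the maximum where it exists and unspecified otherwise; \<open>Max\<close> is only
  meaningful for finite sets.\<close>

definition root_d :: "('a::euclidean_space \<Rightarrow> 'a \<Rightarrow> bool) \<Rightarrow> 'a set \<Rightarrow> 'a \<Rightarrow> real" where
  "root_d lt \<Phi> \<psi> = (GREATEST r. r \<in> (\<lambda>x. sqrt (x \<bullet> x)) ` alcove_face lt \<Phi> \<psi>)"

end

theory Submission
  imports Defs
begin

text \<open>The maximum of the convex function \<open>(x, x)\<close> on the simplex \<open>\<triangle>'\<close> is attained at a vertex, and the
  vertices are \<open>\<omega>\<^sub>i / m\<^sub>i\<close>, where the \<open>\<omega>\<^sub>i\<close> are dual to the simple roots and \<open>\<psi> = \<Sum> m\<^sub>i \<alpha>\<^sub>i\<close>.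
  In types B, C, D and BC the inequalities \<open>x\<^sub>1 \<ge> x\<^sub>2 \<ge> \<dots>\<close> in the coordinates of an orthogonal frame
  bound \<open>(x, x)\<close> directly. To identify \<open>\<psi>\<close>, which is only known to be greatest for the ordering: of two
  dominant roots of an irreducible system the smaller one is strictly shorter, because their difference
  is a positive root. Hence \<open>\<psi>\<close> is a longest root, and the only dominant one among these. In the exceptional types
  the integrality of the coefficients of \<open>\<psi>\<close> and the equality case of Cauchy-Schwarz identify it.\<close>

section \<open>Ordered root systems\<close>

text \<open>A type prescribes only the Gram matrix of the simple roots; \<Phi> itself is never
  listed. So everything has to be drawn from \<Delta>. In the classical types chains of reflections
  starting at simple roots show that the proposed \<psi> is a root, and \<open>root_length\<close>,
  which reduces every root length to that of a simple root or of its double, shows that it is long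
  enough. No Weyl group is formed: single reflections and descent along the ordering, over finitely
  many roots, do its work. Frames spare the types B, C, D an inverse matrix for every rank. Type A
  has no such frame inside V, because its l simple roots are differences of l + 1 orthogonal
  vectors; there the inverse Cartan matrix has a short closed form. The exceptional types use
  tables, and \<psi> is compared with a candidate that need not be known to be a root beforehand. A
  nonreduced system has the same simple roots as its indivisible part, so the type B frame serves it
  too, and only \<psi> changes. Since \<open>root_d\<close> is a \<open>GREATEST\<close>, that the
  maximum exists is a separate compactness argument, uniform in the type.\<close>

locale ordered_root_system =
  fixes \<Phi> :: "'a::euclidean_space set" and lt :: "'a \<Rightarrow> 'a \<Rightarrow> bool"
  assumes root_system: "root_system \<Phi>" and ordering: "vector_ordering lt"
begin

abbreviation "\<Delta> \<equiv> simple_roots lt \<Phi>"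

section \<open>Positive vectors and their nonnegative combinations\<close>

lemma lt_irrefl: "\<not> lt x x"
  and lt_trans: "lt x y \<Longrightarrow> lt y z \<Longrightarrow> lt x z"
  and lt_total: "lt x y \<or> x = y \<or> lt y x"
  and lt_add: "lt x y \<Longrightarrow> lt (x + z) (y + z)"
  and lt_scale: "lt x y \<Longrightarrow> c > 0 \<Longrightarrow> lt (c *\<^sub>R x) (c *\<^sub>R y)"
  using ordering unfolding vector_ordering_def by blast+

lemma lt_iff_diff: "lt x y \<longleftrightarrow> lt 0 (y - x)"
  using lt_add[of x y "-x"] lt_add[of 0 "y - x" x] by auto

lemma pos_add: "lt 0 x \<Longrightarrow> lt 0 y \<Longrightarrow> lt 0 (x + y)"
  using lt_trans[of 0 y "x + y"] lt_add[of 0 x y] by simp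

lemma pos_scale: "lt 0 x \<Longrightarrow> c > 0 \<Longrightarrow> lt 0 (c *\<^sub>R x)"
  using lt_scale[of 0 x c] by simp

lemma pos_cases: "lt 0 x \<or> x = 0 \<or> lt 0 (- x)"
  using lt_total[of 0 x] lt_iff_diff[of x 0] by auto

lemma nonneg_combination:
  assumes "finite A" "\<And>a. a \<in> A \<Longrightarrow> lt 0 (f a)" "\<And>a. a \<in> A \<Longrightarrow> c a \<ge> 0"
  shows "(\<Sum>a\<in>A. c a *\<^sub>R f a) = 0 \<or> lt 0 (\<Sum>a\<in>A. c a *\<^sub>R f a)"
  using assms
proof (induction A rule: finite_induct)
  case (insert a A)
  have "c a *\<^sub>R f a = 0 \<or> lt 0 (c a *\<^sub>R f a)"
    using insert.prems pos_scale[of "f a" "c a"] by (cases "c a = 0") (auto simp: order_le_less)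
  with insert show ?case using pos_add by auto
qed simp

lemma pos_combination:
  assumes "finite A" "\<And>a. a \<in> A \<Longrightarrow> lt 0 (f a)" "\<And>a. a \<in> A \<Longrightarrow> c a \<ge> 0"
    and "b \<in> A" "c b > 0"
  shows "lt 0 (\<Sum>a\<in>A. c a *\<^sub>R f a)"
proof -
  have "(\<Sum>a\<in>A. c a *\<^sub>R f a) = c b *\<^sub>R f b + (\<Sum>a\<in>A-{b}. c a *\<^sub>R f a)"
    using assms by (simp add: sum.remove)
  moreover have "lt 0 (c b *\<^sub>R f b)" using assms pos_scale by auto
  moreover have "(\<Sum>a\<in>A-{b}. c a *\<^sub>R f a) = 0 \<or> lt 0 (\<Sum>a\<in>A-{b}. c a *\<^sub>R f a)"
    using assms by (intro nonneg_combination) auto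
  ultimately show ?thesis using pos_add by auto
qed

lemma finite_has_greatest:
  assumes "finite S" "S \<noteq> {}"
  shows "\<exists>m\<in>S. \<forall>x\<in>S. x \<noteq> m \<longrightarrow> lt x m"
  using assms
proof (induction rule: finite_ne_induct)
  case (insert a S)
  then obtain m where m: "m \<in> S" "\<forall>x\<in>S. x \<noteq> m \<longrightarrow> lt x m" by blast
  from lt_total[of a m] show ?case
  proof (elim disjE)
    assume "lt m a"
    then have "\<forall>x\<in>insert a S. x \<noteq> a \<longrightarrow> lt x a" using m lt_trans[of _ m a] by (metis insert_iff)
    then show ?thesis by blast
  qed (use m in auto)
qed simp

section \<open>Reflections and Cartan integers\<close>

lemma finite_roots: "finite \<Phi>"
  and zero_not_root: "0 \<notin> \<Phi>"
  and span_roots: "span \<Phi> = UNIV"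
  and reflection_root: "\<alpha> \<in> \<Phi> \<Longrightarrow> \<beta> \<in> \<Phi> \<Longrightarrow> \<beta> - (2 * (\<beta> \<bullet> \<alpha>) / (\<alpha> \<bullet> \<alpha>)) *\<^sub>R \<alpha> \<in> \<Phi>"
  and cartan_integer: "\<alpha> \<in> \<Phi> \<Longrightarrow> \<beta> \<in> \<Phi> \<Longrightarrow> 2 * (\<beta> \<bullet> \<alpha>) / (\<alpha> \<bullet> \<alpha>) \<in> \<int>"
  using root_system unfolding root_system_def by blast+

lemma root_inner_pos: "\<alpha> \<in> \<Phi> \<Longrightarrow> \<alpha> \<bullet> \<alpha> > 0"
  using zero_not_root by auto

lemma uminus_root: "\<alpha> \<in> \<Phi> \<Longrightarrow> - \<alpha> \<in> \<Phi>"
  using reflection_root[of \<alpha> \<alpha>] root_inner_pos[of \<alpha>] by (simp add: scaleR_2)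

lemma root_pos_cases: "\<alpha> \<in> \<Phi> \<Longrightarrow> \<alpha> \<in> positive_roots lt \<Phi> \<or> - \<alpha> \<in> positive_roots lt \<Phi>"
  using pos_cases[of \<alpha>] zero_not_root uminus_root by (auto simp: positive_roots_def)

lemma inner_reflection:
  fixes \<alpha> \<beta> :: 'a
  assumes "\<alpha> \<noteq> 0"
  defines "\<gamma> \<equiv> \<beta> - (2 * (\<beta> \<bullet> \<alpha>) / (\<alpha> \<bullet> \<alpha>)) *\<^sub>R \<alpha>"
  shows "\<gamma> \<bullet> \<gamma> = \<beta> \<bullet> \<beta>"
proof -
  have "\<alpha> \<bullet> \<alpha> \<noteq> 0" using assms by simp
  then show ?thesis unfolding \<gamma>_def
    by (simp add: inner_diff inner_commute[of \<alpha> \<beta>] power2_eq_square field_simps)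
qed

text \<open>Expanding the square of \<open>x - y\<close> leaves at most zero. This form of the
  equality case of Cauchy-Schwarz identifies a vector from one inner product and a comparison of
  lengths.\<close>

lemma eq_of_inner_eq:
  fixes x y :: 'a
  assumes "x \<bullet> x \<le> y \<bullet> y" "y \<bullet> y \<le> x \<bullet> y"
  shows "x = y"
proof -
  have "(x - y) \<bullet> (x - y) = x \<bullet> x - 2 * (x \<bullet> y) + y \<bullet> y"
    by (simp add: inner_diff inner_commute)
  then have "(x - y) \<bullet> (x - y) \<le> 0" using assms by linarith
  then show ?thesis by (metis inner_gt_zero_iff not_le right_minus_eq)
qed

text \<open>If one of the two Cartan integers is 1, a reflection subtracts one root from the other
  exactly once. Both are positive, so otherwise both are at least 2; then both squared lengths are
  bounded by the inner product, which forces the roots to coincide. Proportional roots such as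
  \<alpha> = 2 \<beta> are covered.\<close>

lemma diff_root:
  assumes "\<alpha> \<in> \<Phi>" "\<beta> \<in> \<Phi>" "\<alpha> \<noteq> \<beta>" "\<alpha> \<bullet> \<beta> > 0"
  shows "\<alpha> - \<beta> \<in> \<Phi>"
proof -
  obtain m :: int where m: "2 * (\<alpha> \<bullet> \<beta>) / (\<beta> \<bullet> \<beta>) = m"
    using cartan_integer[OF assms(2,1)] Ints_cases by blast
  obtain n :: int where n: "2 * (\<alpha> \<bullet> \<beta>) / (\<alpha> \<bullet> \<alpha>) = n"
    using cartan_integer[OF assms(1,2)] Ints_cases by (metis inner_commute)
  have pos: "\<alpha> \<bullet> \<alpha> > 0" "\<beta> \<bullet> \<beta> > 0" using assms root_inner_pos by auto
  have "real_of_int m > 0" "real_of_int n > 0" using m n pos assms(4) by (metis divide_pos_pos mult_pos_pos zero_less_numeral)+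
  then have mn: "m \<ge> 1" "n \<ge> 1" by auto
  consider "m = 1" | "n = 1" | "m \<ge> 2" "n \<ge> 2" using mn by linarith
  then show ?thesis
  proof cases
    case 1
    then show ?thesis using reflection_root[OF assms(2,1)] m by simp
  next
    case 2
    then have "\<beta> - \<alpha> \<in> \<Phi>" using reflection_root[OF assms(1,2)] n by (simp add: inner_commute)
    then show ?thesis using uminus_root by fastforce
  next
    case 3
    have "2 * (\<alpha> \<bullet> \<beta>) = m * (\<beta> \<bullet> \<beta>)" "2 * (\<alpha> \<bullet> \<beta>) = n * (\<alpha> \<bullet> \<alpha>)"
      using m n pos by (simp_all add: field_simps)
    moreover have "2 * (\<beta> \<bullet> \<beta>) \<le> m * (\<beta> \<bullet> \<beta>)" "2 * (\<alpha> \<bullet> \<alpha>) \<le> n * (\<alpha> \<bullet> \<alpha>)"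
      using 3 pos by (auto intro!: mult_right_mono)
    ultimately have le: "\<beta> \<bullet> \<beta> \<le> \<alpha> \<bullet> \<beta>" "\<alpha> \<bullet> \<alpha> \<le> \<alpha> \<bullet> \<beta>" by auto
    have "(\<alpha> - \<beta>) \<bullet> (\<alpha> - \<beta>) = \<alpha> \<bullet> \<alpha> - 2 * (\<alpha> \<bullet> \<beta>) + \<beta> \<bullet> \<beta>"
      by (simp add: inner_diff inner_commute)
    then have "(\<alpha> - \<beta>) \<bullet> (\<alpha> - \<beta>) \<le> 0" using le by linarith
    then show ?thesis using assms(3) by (metis inner_gt_zero_iff not_le right_minus_eq)
  qed
qed

section \<open>The simple roots as a base\<close>

lemma simple_pos: "\<delta> \<in> \<Delta> \<Longrightarrow> lt 0 \<delta>"
  and simple_root: "\<delta> \<in> \<Delta> \<Longrightarrow> \<delta> \<in> \<Phi>"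
  by (auto simp: simple_roots_def positive_roots_def)

lemma finite_simple: "finite \<Delta>"
  by (rule finite_subset[OF _ finite_roots]) (use simple_root in auto)

text \<open>The ordering of V is not well-founded, but the number of roots below \<alpha> is finite
  and drops strictly on passing to a smaller root.\<close>

lemma pos_less_induct [consumes 1, case_names less]:
  assumes "\<alpha> \<in> positive_roots lt \<Phi>"
    and "\<And>\<alpha>. \<alpha> \<in> positive_roots lt \<Phi> \<Longrightarrow>
           (\<And>\<beta>. \<beta> \<in> positive_roots lt \<Phi> \<Longrightarrow> lt \<beta> \<alpha> \<Longrightarrow> P \<beta>) \<Longrightarrow> P \<alpha>"
  shows "P \<alpha>"
  using assms(1)
proof (induction "card {\<beta>\<in>\<Phi>. lt \<beta> \<alpha>}" arbitrary: \<alpha> rule: less_induct)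
  case less
  show ?case
  proof (rule assms(2)[OF less.prems])
    fix \<beta> assume \<beta>: "\<beta> \<in> positive_roots lt \<Phi>" "lt \<beta> \<alpha>"
    have "{\<gamma>\<in>\<Phi>. lt \<gamma> \<beta>} \<subset> {\<gamma>\<in>\<Phi>. lt \<gamma> \<alpha>}"
      using \<beta> lt_trans lt_irrefl unfolding positive_roots_def by blast
    then show "P \<beta>" using less.hyps \<beta>(1) finite_roots by (simp add: psubset_card_mono)
  qed
qed

text \<open>A substitute for induction on the height: a positive root that is not simple is a sum of
  two positive roots, and each summand is smaller because the other one is positive.\<close>

lemma pos_root_induct [consumes 1, case_names simple add]:
  assumes "\<alpha> \<in> positive_roots lt \<Phi>"
    and simple: "\<And>\<delta>. \<delta> \<in> \<Delta> \<Longrightarrow> P \<delta>"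
    and add: "\<And>\<beta> \<gamma>. \<beta> \<in> positive_roots lt \<Phi> \<Longrightarrow> \<gamma> \<in> positive_roots lt \<Phi> \<Longrightarrow>
                \<beta> + \<gamma> \<in> \<Phi> \<Longrightarrow> P \<beta> \<Longrightarrow> P \<gamma> \<Longrightarrow> P (\<beta> + \<gamma>)"
  shows "P \<alpha>"
  using assms(1)
proof (induction rule: pos_less_induct)
  case (less \<alpha>)
  note \<alpha> = less(1) and IH = less(2)
  show ?case
  proof (cases "\<alpha> \<in> \<Delta>")
    case False
    then obtain \<beta> \<gamma> where *: "\<beta> \<in> positive_roots lt \<Phi>" "\<gamma> \<in> positive_roots lt \<Phi>" "\<alpha> = \<beta> + \<gamma>"
      using \<alpha> by (auto simp: simple_roots_def)
    then have "lt \<beta> \<alpha>" "lt \<gamma> \<alpha>"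
      using lt_iff_diff[of \<beta> \<alpha>] lt_iff_diff[of \<gamma> \<alpha>] by (auto simp: positive_roots_def)
    then have "P (\<beta> + \<gamma>)"
      using * IH \<alpha> by (intro add) (auto simp: positive_roots_def)
    then show ?thesis using * by simp
  qed (rule simple)
qed

lemma pos_root_combination:
  assumes "\<alpha> \<in> positive_roots lt \<Phi>"
  shows "\<exists>n :: 'a \<Rightarrow> nat. \<alpha> = (\<Sum>\<delta>\<in>\<Delta>. real (n \<delta>) *\<^sub>R \<delta>)"
  using assms
proof (induction rule: pos_root_induct)
  case (simple \<delta>)
  have "(\<Sum>\<epsilon>\<in>\<Delta>. real (if \<epsilon> = \<delta> then 1 else 0) *\<^sub>R \<epsilon>) = (\<Sum>\<epsilon>\<in>\<Delta>. if \<epsilon> = \<delta> then \<epsilon> else 0)"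
    by (intro sum.cong) auto
  also have "\<dots> = \<delta>" using simple finite_simple by simp
  finally show ?case by metis
next
  case (add \<beta> \<gamma>)
  then obtain m n :: "'a \<Rightarrow> nat" where
    "\<beta> = (\<Sum>\<delta>\<in>\<Delta>. real (m \<delta>) *\<^sub>R \<delta>)" "\<gamma> = (\<Sum>\<delta>\<in>\<Delta>. real (n \<delta>) *\<^sub>R \<delta>)" by blast
  then show ?case
    by (intro exI[of _ "\<lambda>\<delta>. m \<delta> + n \<delta>"]) (simp only: of_nat_add scaleR_add_left sum.distrib)
qed

lemma span_simple: "span \<Delta> = UNIV"
proof -
  have pos: "\<alpha> \<in> span \<Delta>" if "\<alpha> \<in> positive_roots lt \<Phi>" for \<alpha>
    using that by (induction rule: pos_root_induct) (auto intro: span_base span_add)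
  have "\<alpha> \<in> span \<Delta>" if "\<alpha> \<in> \<Phi>" for \<alpha>
    using root_pos_cases[OF that] pos[of \<alpha>] pos[of "-\<alpha>"] span_neg[of "-\<alpha>" \<Delta>] by auto
  then have "span \<Phi> \<subseteq> span \<Delta>" by (intro span_minimal) auto
  then show ?thesis using span_roots by auto
qed

lemma eq_if_inner_simple:
  assumes "\<And>\<delta>. \<delta> \<in> \<Delta> \<Longrightarrow> x \<bullet> \<delta> = y \<bullet> \<delta>"
  shows "x = y"
proof -
  have "orthogonal (x - y) z" for z
    by (rule orthogonal_to_span[where S = \<Delta>])
      (use span_simple assms in \<open>auto simp: orthogonal_def inner_diff\<close>)
  then have "(x - y) \<bullet> (x - y) = 0" unfolding orthogonal_def by blast
  then show ?thesis by simp
qed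

text \<open>With a positive inner product the difference would be a root. Whatever its sign, it
  would decompose one of the two simple roots as the other plus a positive root.\<close>

lemma simple_obtuse:
  assumes "\<alpha> \<in> \<Delta>" "\<beta> \<in> \<Delta>" "\<alpha> \<noteq> \<beta>"
  shows "\<alpha> \<bullet> \<beta> \<le> 0"
proof (rule ccontr)
  assume "\<not> ?thesis"
  then have d: "\<alpha> - \<beta> \<in> \<Phi>" using diff_root assms simple_root by force
  from root_pos_cases[OF d] show False
  proof
    assume "\<alpha> - \<beta> \<in> positive_roots lt \<Phi>"
    moreover have "\<alpha> = \<beta> + (\<alpha> - \<beta>)" by simp
    ultimately show False using assms unfolding simple_roots_def by blast
  next
    assume "- (\<alpha> - \<beta>) \<in> positive_roots lt \<Phi>"
    moreover have "\<beta> = \<alpha> + - (\<alpha> - \<beta>)" by simp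
    ultimately show False using assms unfolding simple_roots_def by blast
  qed
qed

text \<open>The terms with positive coefficients form a vector v, equal to minus the remaining
  terms. By obtuse angles v has nonpositive inner product with itself, so v = 0; yet a nontrivial
  nonnegative combination of positive vectors is positive. Applied to \<open>c\<close> and to its
  negative, this gives linear independence.\<close>

lemma simple_combination_nonpos:
  assumes "(\<Sum>\<delta>\<in>\<Delta>. c \<delta> *\<^sub>R \<delta>) = 0" "\<delta> \<in> \<Delta>"
  shows "c \<delta> \<le> 0"
proof (rule ccontr)
  assume c: "\<not> c \<delta> \<le> 0"
  define P where "P = {\<delta>\<in>\<Delta>. c \<delta> > 0}"
  define v where "v = (\<Sum>\<delta>\<in>P. c \<delta> *\<^sub>R \<delta>)"
  have P: "P \<subseteq> \<Delta>" "finite P" using finite_simple by (auto simp: P_def)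
  have "v + (\<Sum>\<delta>\<in>\<Delta>-P. c \<delta> *\<^sub>R \<delta>) = 0"
    using sum.subset_diff[OF P(1) finite_simple, of "\<lambda>\<delta>. c \<delta> *\<^sub>R \<delta>"] assms(1)
    by (simp add: v_def add.commute)
  then have v2: "v = - (\<Sum>\<delta>\<in>\<Delta>-P. c \<delta> *\<^sub>R \<delta>)" by (simp add: eq_neg_iff_add_eq_0)
  have "v \<bullet> v = - (\<Sum>\<delta>\<in>P. \<Sum>\<epsilon>\<in>\<Delta>-P. c \<delta> * c \<epsilon> * (\<delta> \<bullet> \<epsilon>))"
    by (subst v2) (simp add: v_def inner_sum_left inner_sum_right sum_distrib_left mult_ac
        sum.swap[of _ P])
  also have "\<dots> = (\<Sum>\<delta>\<in>P. \<Sum>\<epsilon>\<in>\<Delta>-P. c \<delta> * (- c \<epsilon>) * (\<delta> \<bullet> \<epsilon>))"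
    by (simp add: sum_negf)
  also have "\<dots> \<le> 0"
    by (intro sum_nonpos mult_nonneg_nonpos mult_nonneg_nonneg simple_obtuse) (auto simp: P_def)
  finally have "v = 0" by (metis inner_gt_zero_iff not_le)
  moreover have "lt 0 v" unfolding v_def
    by (rule pos_combination[where b = \<delta>]) (use P c assms(2) simple_pos in \<open>auto simp: P_def\<close>)
  ultimately show False using lt_irrefl by simp
qed

lemma simple_combination_zero:
  assumes "(\<Sum>\<delta>\<in>\<Delta>. c \<delta> *\<^sub>R \<delta>) = 0" "\<delta> \<in> \<Delta>"
  shows "c \<delta> = 0"
  using simple_combination_nonpos[OF assms] assms
    simple_combination_nonpos[of "\<lambda>\<delta>. - c \<delta>" \<delta>] by (simp add: sum_negf)

lemma independent_simple: "independent \<Delta>"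
  unfolding dependent_finite[OF finite_simple] using simple_combination_zero by blast

lemma card_simple: "card \<Delta> = DIM('a)"
  using dim_eq_card_independent[OF independent_simple] span_simple by (metis dim_UNIV dim_span)

text \<open>Reflecting a positive root in a simple root with which it has positive inner product
  makes it smaller and keeps its length. The descent stops when the reflected root is negative,
  which happens only for a multiple of that simple root, and integrality leaves the factors 1 and 2.
  The factor 2 allows for nonreduced systems.\<close>

lemma root_length:
  assumes "\<beta> \<in> \<Phi>"
  obtains \<delta> c where "\<delta> \<in> \<Delta>" "c = 1 \<or> c = (2::real)" "c *\<^sub>R \<delta> \<in> \<Phi>" "\<beta> \<bullet> \<beta> = c\<^sup>2 * (\<delta> \<bullet> \<delta>)"
proof -
  have main: "\<exists>\<delta>\<in>\<Delta>. \<exists>c::real. (c = 1 \<or> c = 2) \<and> c *\<^sub>R \<delta> \<in> \<Phi> \<and> \<beta> \<bullet> \<beta> = c\<^sup>2 * (\<delta> \<bullet> \<delta>)"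
    if "\<beta> \<in> positive_roots lt \<Phi>" for \<beta>
    using that
  proof (induction rule: pos_less_induct)
    case (less \<beta>)
    note \<beta> = less(1) and IH = less(2)
    have root: "\<beta> \<in> \<Phi>" using \<beta> by (simp add: positive_roots_def)
    obtain n :: "'a \<Rightarrow> nat" where n: "\<beta> = (\<Sum>\<delta>\<in>\<Delta>. real (n \<delta>) *\<^sub>R \<delta>)"
      using pos_root_combination[OF \<beta>] by blast
    \<comment> \<open>Otherwise expanding one factor of \<beta> \<bullet> \<beta> in the simple
      roots, with nonnegative coefficients, would make it nonpositive.\<close>
    have "\<exists>\<delta>\<in>\<Delta>. \<beta> \<bullet> \<delta> > 0"
    proof (rule ccontr)
      assume "\<not> ?thesis"
      then have "(\<Sum>\<delta>\<in>\<Delta>. real (n \<delta>) * (\<beta> \<bullet> \<delta>)) \<le> 0"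
        by (intro sum_nonpos mult_nonneg_nonpos) auto
      also have "(\<Sum>\<delta>\<in>\<Delta>. real (n \<delta>) * (\<beta> \<bullet> \<delta>)) = \<beta> \<bullet> \<beta>"
        by (subst (3) n) (simp add: inner_sum_right)
      finally show False using root_inner_pos[OF root] by simp
    qed
    then obtain \<delta> where \<delta>: "\<delta> \<in> \<Delta>" "\<beta> \<bullet> \<delta> > 0" by blast
    have \<delta>\<delta>: "\<delta> \<bullet> \<delta> > 0" using \<delta> simple_root root_inner_pos by blast
    define k where "k = 2 * (\<beta> \<bullet> \<delta>) / (\<delta> \<bullet> \<delta>)"
    define \<gamma> where "\<gamma> = \<beta> - k *\<^sub>R \<delta>"
    have k: "k > 0" using \<delta> \<delta>\<delta> by (simp add: k_def)
    have \<gamma>: "\<gamma> \<in> \<Phi>" "\<gamma> \<bullet> \<gamma> = \<beta> \<bullet> \<beta>"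
      using reflection_root[OF simple_root[OF \<delta>(1)] root] inner_reflection[of \<delta> \<beta>] \<delta>\<delta>
      by (auto simp: \<gamma>_def k_def)
    have less: "lt \<gamma> \<beta>"
      using pos_scale[OF simple_pos[OF \<delta>(1)] k] lt_iff_diff[of \<gamma> \<beta>] by (simp add: \<gamma>_def)
    from root_pos_cases[OF \<gamma>(1)]
    show ?case
    proof
      assume "\<gamma> \<in> positive_roots lt \<Phi>"
      then show ?thesis using IH[OF _ less] \<gamma> by metis
    next
      assume "- \<gamma> \<in> positive_roots lt \<Phi>"
      then obtain n' :: "'a \<Rightarrow> nat" where n': "- \<gamma> = (\<Sum>\<delta>\<in>\<Delta>. real (n' \<delta>) *\<^sub>R \<delta>)"
        using pos_root_combination by blast
      \<comment> \<open>\<beta> and - \<gamma> have nonnegative coefficients and add up to k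
        \<delta>, so independence kills every coefficient of \<beta> except the one at
        \<delta>.\<close>
      have "(\<Sum>\<epsilon>\<in>\<Delta>. (if \<epsilon> = \<delta> then k else 0) *\<^sub>R \<epsilon>) = (\<Sum>\<epsilon>\<in>\<Delta>. if \<epsilon> = \<delta> then k *\<^sub>R \<epsilon> else 0)"
        by (rule sum.cong) auto
      then have "(\<Sum>\<epsilon>\<in>\<Delta>. (if \<epsilon> = \<delta> then k else 0) *\<^sub>R \<epsilon>) = \<beta> + - \<gamma>"
        using \<delta> finite_simple by (simp add: \<gamma>_def)
      then have "(\<Sum>\<epsilon>\<in>\<Delta>. (real (n \<epsilon>) + real (n' \<epsilon>) - (if \<epsilon> = \<delta> then k else 0)) *\<^sub>R \<epsilon>)
          = (\<Sum>\<epsilon>\<in>\<Delta>. real (n \<epsilon>) *\<^sub>R \<epsilon>) + (\<Sum>\<epsilon>\<in>\<Delta>. real (n' \<epsilon>) *\<^sub>R \<epsilon>) - (\<beta> + - \<gamma>)"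
        by (simp only: sum.distrib sum_subtractf scaleR_add_left scaleR_diff_left)
      also have "\<dots> = 0" unfolding n[symmetric] n'[symmetric] by simp
      finally have "\<forall>\<epsilon>\<in>\<Delta>. real (n \<epsilon>) + real (n' \<epsilon>) - (if \<epsilon> = \<delta> then k else 0) = 0"
        using simple_combination_zero[of "\<lambda>\<epsilon>. real (n \<epsilon>) + real (n' \<epsilon>) - (if \<epsilon> = \<delta> then k else 0)"] by blast
      then have z: "n \<epsilon> = 0" if "\<epsilon> \<in> \<Delta>" "\<epsilon> \<noteq> \<delta>" for \<epsilon> using that by fastforce
      have "\<beta> = (\<Sum>\<epsilon>\<in>\<Delta>. if \<epsilon> = \<delta> then real (n \<delta>) *\<^sub>R \<epsilon> else 0)"
        by (subst n, rule sum.cong) (use z in auto)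
      then have \<beta>n: "\<beta> = real (n \<delta>) *\<^sub>R \<delta>" using finite_simple \<delta> by simp
      then have n0: "n \<delta> > 0" using root zero_not_root by (cases "n \<delta> = 0") auto
      \<comment> \<open>The Cartan integer of \<delta> relative to its n-fold is 2 / n, so n divides
        2.\<close>
      have "2 * (\<delta> \<bullet> \<beta>) / (\<beta> \<bullet> \<beta>) = 2 / n \<delta>" unfolding \<beta>n using n0 \<delta>\<delta> by (simp add: field_simps)
      then have "2 / real (n \<delta>) \<in> \<int>" using cartan_integer[OF root simple_root[OF \<delta>(1)]] by simp
      then obtain z :: int where z: "2 / real (n \<delta>) = z" using Ints_cases by blast
      then have "real_of_int (z * int (n \<delta>)) = real_of_int 2" using n0 by (simp add: field_simps)
      then have "z * int (n \<delta>) = 2" by (simp only: of_int_eq_iff)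
      then have "int (n \<delta>) dvd 2" by (metis dvd_triv_right)
      then have "int (n \<delta>) \<le> 2" by (rule zdvd_imp_le) simp
      then have "real (n \<delta>) = 1 \<or> real (n \<delta>) = 2" using n0 by auto
      moreover have "\<beta> \<bullet> \<beta> = (real (n \<delta>))\<^sup>2 * (\<delta> \<bullet> \<delta>)"
        by (subst (1 2) \<beta>n) (simp add: power2_eq_square)
      ultimately show ?thesis using \<delta>(1) root unfolding \<beta>n[symmetric]
        by (intro bexI[of _ \<delta>] exI[of _ "real (n \<delta>)"]) (auto simp flip: \<beta>n)
    qed
  qed
  obtain \<gamma> where \<gamma>: "\<gamma> \<in> positive_roots lt \<Phi>" "\<gamma> \<bullet> \<gamma> = \<beta> \<bullet> \<beta>"
    using root_pos_cases[OF assms] by (metis inner_minus_left inner_minus_right minus_minus)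
  show ?thesis using main[OF \<gamma>(1)] \<gamma>(2) that by metis
qed

end

section \<open>Irreducibility and the highest root\<close>

locale irreducible_ordered_root_system = ordered_root_system +
  assumes irreducible: "irreducible_roots \<Phi>"
begin

text \<open>A simple root missing from \<beta> has nonpositive inner product with \<beta> by obtuse
  angles and a nonnegative one by dominance. It is then orthogonal to every simple root that occurs,
  and this splitting of \<Delta> into orthogonal parts extends to \<Phi>, against
  irreducibility.\<close>

lemma dominant_root_combination:
  assumes "\<beta> \<in> \<Phi>" and dominant: "\<And>\<delta>. \<delta> \<in> \<Delta> \<Longrightarrow> \<beta> \<bullet> \<delta> \<ge> 0"
  obtains n :: "'a \<Rightarrow> nat" where "\<beta> = (\<Sum>\<delta>\<in>\<Delta>. real (n \<delta>) *\<^sub>R \<delta>)" "\<And>\<delta>. \<delta> \<in> \<Delta> \<Longrightarrow> n \<delta> > 0"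
proof -
  \<comment> \<open>If \<beta> were negative, expanding - \<beta> in simple roots would give \<beta>
    \<bullet> (- \<beta>) \<ge> 0.\<close>
  have "\<beta> \<in> positive_roots lt \<Phi>"
  proof (rule ccontr)
    assume "\<not> ?thesis"
    then obtain n :: "'a \<Rightarrow> nat" where n: "- \<beta> = (\<Sum>\<delta>\<in>\<Delta>. real (n \<delta>) *\<^sub>R \<delta>)"
      using root_pos_cases[OF assms(1)] pos_root_combination by blast
    have "0 \<le> (\<Sum>\<delta>\<in>\<Delta>. real (n \<delta>) * (\<beta> \<bullet> \<delta>))"
      by (rule sum_nonneg) (simp add: dominant)
    also have "\<dots> = \<beta> \<bullet> (- \<beta>)" by (simp only: n inner_sum_right inner_scaleR_right)
    finally have "\<beta> \<bullet> (- \<beta>) \<ge> 0" .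
    then show False using root_inner_pos[OF assms(1)] by simp
  qed
  then obtain n :: "'a \<Rightarrow> nat" where n: "\<beta> = (\<Sum>\<delta>\<in>\<Delta>. real (n \<delta>) *\<^sub>R \<delta>)"
    using pos_root_combination by blast
  define D0 where "D0 = {\<delta>\<in>\<Delta>. n \<delta> = 0}"
  define D1 where "D1 = \<Delta> - D0"
  have sub: "D0 \<subseteq> \<Delta>" "D1 \<subseteq> \<Delta>" "\<Delta> = D0 \<union> D1" "D0 \<inter> D1 = {}" "finite D0" "finite D1"
    using finite_simple by (auto simp: D0_def D1_def)
  have orth_simple: "\<epsilon> \<bullet> \<delta> = 0" if \<delta>: "\<delta> \<in> D0" and \<epsilon>: "\<epsilon> \<in> D1" for \<delta> \<epsilon>
  proof -
    have "\<beta> = (\<Sum>\<epsilon>\<in>D1. real (n \<epsilon>) *\<^sub>R \<epsilon>)"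
      by (subst n, rule sum.mono_neutral_right) (use finite_simple in \<open>auto simp: D0_def D1_def\<close>)
    then have eq: "\<beta> \<bullet> \<delta> = (\<Sum>\<epsilon>\<in>D1. real (n \<epsilon>) * (\<epsilon> \<bullet> \<delta>))"
      using arg_cong[of _ _ "\<lambda>x. x \<bullet> \<delta>"] by (fastforce simp: inner_sum_left)
    have le: "real (n \<epsilon>) * (\<epsilon> \<bullet> \<delta>) \<le> 0" if "\<epsilon> \<in> D1" for \<epsilon>
      using that \<delta> sub by (intro mult_nonneg_nonpos simple_obtuse) auto
    \<comment> \<open>All terms of \<beta> \<bullet> \<delta> are nonpositive while their sum is
      nonnegative, so each term vanishes, and on \<open>D1\<close> the factor n \<epsilon> can be
      cancelled.\<close>
    have "(\<Sum>\<epsilon>\<in>D1. - (real (n \<epsilon>) * (\<epsilon> \<bullet> \<delta>))) = 0"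
      using sum_nonpos[of D1 "\<lambda>\<epsilon>. real (n \<epsilon>) * (\<epsilon> \<bullet> \<delta>)"] le eq dominant[of \<delta>] \<delta> sub
      by (auto simp: sum_negf)
    then have "- (real (n \<epsilon>) * (\<epsilon> \<bullet> \<delta>)) = 0"
      using sum_nonneg_eq_0_iff[OF \<open>finite D1\<close>, of "\<lambda>\<epsilon>. - (real (n \<epsilon>) * (\<epsilon> \<bullet> \<delta>))"] le \<epsilon> by auto
    then show ?thesis using \<epsilon> by (auto simp: D1_def D0_def)
  qed
  have orth: "x \<bullet> y = 0" if x: "x \<in> span D0" and y: "y \<in> span D1" for x y
  proof -
    have "orthogonal x \<epsilon>" if "\<epsilon> \<in> D1" for \<epsilon>
      using orthogonal_to_span[OF x, of \<epsilon>] orth_simple that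
      by (auto simp: orthogonal_def inner_commute)
    then show ?thesis using orthogonal_to_span[OF y, of x] by (auto simp: orthogonal_def)
  qed
  text \<open>If a root were a sum of positive roots from the two orthogonal parts, then the difference
    of these would also be a root, with coefficients of both signs.\<close>
  have mixed: False
    if sp: "(\<beta> \<in> span D0 \<and> \<gamma> \<in> span D1) \<or> (\<beta> \<in> span D1 \<and> \<gamma> \<in> span D0)"
      and pos: "lt 0 \<gamma>" and d: "\<beta> - \<gamma> \<in> positive_roots lt \<Phi>" for \<beta> \<gamma>
  proof -
    obtain k :: "'a \<Rightarrow> nat" where k: "\<beta> - \<gamma> = (\<Sum>\<delta>\<in>\<Delta>. real (k \<delta>) *\<^sub>R \<delta>)"
      using pos_root_combination[OF d] by blast
    define s where "s = (\<lambda>D. \<Sum>\<delta>\<in>D. real (k \<delta>) *\<^sub>R \<delta>)"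
    have s: "\<beta> - \<gamma> = s D0 + s D1"
      unfolding s_def k using sum.union_disjoint[OF sub(5,6,4), of "\<lambda>\<delta>. real (k \<delta>) *\<^sub>R \<delta>"] sub(3) by simp
    have span: "s D0 \<in> span D0" "s D1 \<in> span D1"
      by (auto simp: s_def intro: span_sum span_scale span_base)
    have nonneg: "s D = 0 \<or> lt 0 (s D)" if "D \<in> {D0, D1}" for D
      unfolding s_def by (rule nonneg_combination) (use sub that simple_pos in auto)
    have "\<gamma> + s D0 = 0 \<or> \<gamma> + s D1 = 0" using sp
    proof
      assume a: "\<beta> \<in> span D0 \<and> \<gamma> \<in> span D1"
      have "\<gamma> + s D1 = \<beta> - s D0" using s by (simp add: algebra_simps)
      moreover have "\<gamma> + s D1 \<in> span D1" "\<beta> - s D0 \<in> span D0"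
        using a span by (auto intro: span_add span_diff)
      ultimately have "(\<gamma> + s D1) \<bullet> (\<gamma> + s D1) = 0"
        using orth[of "\<gamma> + s D1" "\<gamma> + s D1"] by simp
      then show ?thesis by simp
    next
      assume a: "\<beta> \<in> span D1 \<and> \<gamma> \<in> span D0"
      have "\<gamma> + s D0 = \<beta> - s D1" using s by (simp add: algebra_simps)
      moreover have "\<gamma> + s D0 \<in> span D0" "\<beta> - s D1 \<in> span D1"
        using a span by (auto intro: span_add span_diff)
      ultimately have "(\<gamma> + s D0) \<bullet> (\<gamma> + s D0) = 0"
        using orth[of "\<gamma> + s D0" "\<gamma> + s D0"] by simp
      then show ?thesis by simp
    qed
    moreover have "\<gamma> + s D \<noteq> 0" if "D \<in> {D0, D1}" for D
      using nonneg[OF that] pos pos_add[of \<gamma> "s D"] lt_irrefl[of 0] by auto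
    ultimately show False by blast
  qed
  have split: "\<alpha> \<in> span D0 \<or> \<alpha> \<in> span D1" if "\<alpha> \<in> positive_roots lt \<Phi>" for \<alpha>
    using that
  proof (induction rule: pos_root_induct)
    case (simple \<delta>)
    then show ?case using sub by (auto intro: span_base)
  next
    case (add \<beta> \<gamma>)
    have \<beta>\<gamma>: "lt 0 \<beta>" "lt 0 \<gamma>" "\<gamma> \<in> \<Phi>" using add by (auto simp: positive_roots_def)
    show ?case
    proof (rule ccontr)
      assume "\<not> ?thesis"
      then have sp: "(\<beta> \<in> span D0 \<and> \<gamma> \<in> span D1) \<or> (\<beta> \<in> span D1 \<and> \<gamma> \<in> span D0)"
        using add.IH span_add by blast
      then have "\<beta> \<bullet> \<gamma> = 0" using orth by (metis inner_commute)
      \<comment> \<open>Since \<beta> and \<gamma> are orthogonal, reflecting \<beta> + \<gamma> in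
        \<gamma> subtracts 2 \<gamma>.\<close>
      then have "\<beta> - \<gamma> \<in> \<Phi>"
        using reflection_root[OF \<beta>\<gamma>(3) add.hyps(3)] root_inner_pos[OF \<beta>\<gamma>(3)]
        by (simp add: inner_add_left scaleR_2)
      from root_pos_cases[OF this] show False
        using mixed[OF sp \<beta>\<gamma>(2)] mixed[of \<gamma> \<beta>] sp \<beta>\<gamma>(1) by auto
    qed
  qed
  have split': "\<alpha> \<in> span D0 \<or> \<alpha> \<in> span D1" if "\<alpha> \<in> \<Phi>" for \<alpha>
    using root_pos_cases[OF that] split[of \<alpha>] split[of "- \<alpha>"] span_neg[of "-\<alpha>"] by auto
  have disjoint: "\<alpha> \<notin> span D1" if "\<alpha> \<in> \<Phi>" "\<alpha> \<in> span D0" for \<alpha>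
    using orth[of \<alpha> \<alpha>] that root_inner_pos by auto
  have "D0 = {}"
  proof (rule ccontr)
    assume "D0 \<noteq> {}"
    moreover have "D1 \<noteq> {}"
    proof
      assume "D1 = {}"
      then have "\<beta> = 0" by (subst n, intro sum.neutral) (auto simp: D1_def D0_def)
      then show False using assms(1) zero_not_root by simp
    qed
    ultimately obtain \<delta>0 \<delta>1 where "\<delta>0 \<in> D0" "\<delta>1 \<in> D1" by blast
    then have "\<delta>0 \<in> \<Phi> \<inter> span D0" "\<delta>1 \<in> \<Phi> \<inter> span D1"
      using sub simple_root span_base by blast+
    then have "\<Phi> \<inter> span D0 \<noteq> {}" "\<Phi> \<inter> span D1 \<noteq> {}" by blast+
    moreover have "\<Phi> \<inter> span D0 \<union> \<Phi> \<inter> span D1 = \<Phi>" using split' by blast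
    moreover have "\<Phi> \<inter> span D0 \<inter> (\<Phi> \<inter> span D1) = {}" using disjoint by blast
    moreover have "\<forall>\<alpha>\<in>\<Phi> \<inter> span D0. \<forall>\<beta>\<in>\<Phi> \<inter> span D1. \<alpha> \<bullet> \<beta> = 0" using orth by blast
    ultimately have "\<exists>\<Phi>1 \<Phi>2. \<Phi>1 \<noteq> {} \<and> \<Phi>2 \<noteq> {} \<and> \<Phi>1 \<union> \<Phi>2 = \<Phi> \<and> \<Phi>1 \<inter> \<Phi>2 = {} \<and>
        (\<forall>\<alpha>\<in>\<Phi>1. \<forall>\<beta>\<in>\<Phi>2. \<alpha> \<bullet> \<beta> = 0)"
      by (intro exI[of _ "\<Phi> \<inter> span D0"] exI[of _ "\<Phi> \<inter> span D1"] conjI)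
    with irreducible show False unfolding irreducible_roots_def by (elim conjE notE)
  qed
  then have "\<And>\<delta>. \<delta> \<in> \<Delta> \<Longrightarrow> n \<delta> > 0" by (auto simp: D0_def)
  with n show ?thesis by (rule that)
qed

text \<open>Every simple root occurs in \<beta>, and \<gamma>, being nonzero and dominant, has
  positive inner product with at least one of them.\<close>

lemma dominant_roots_inner_pos:
  assumes "\<beta> \<in> \<Phi>" "\<And>\<delta>. \<delta> \<in> \<Delta> \<Longrightarrow> \<beta> \<bullet> \<delta> \<ge> 0"
    and "\<gamma> \<in> \<Phi>" "\<And>\<delta>. \<delta> \<in> \<Delta> \<Longrightarrow> \<gamma> \<bullet> \<delta> \<ge> 0"
  shows "\<beta> \<bullet> \<gamma> > 0"
proof -
  obtain n :: "'a \<Rightarrow> nat" where n: "\<beta> = (\<Sum>\<delta>\<in>\<Delta>. real (n \<delta>) *\<^sub>R \<delta>)" "\<And>\<delta>. \<delta> \<in> \<Delta> \<Longrightarrow> n \<delta> > 0"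
    using dominant_root_combination[OF assms(1,2)] by blast
  have "\<gamma> \<bullet> \<beta> = (\<Sum>\<delta>\<in>\<Delta>. real (n \<delta>) * (\<gamma> \<bullet> \<delta>))"
    unfolding n(1) inner_sum_right inner_scaleR_right ..
  then have eq: "\<beta> \<bullet> \<gamma> = (\<Sum>\<delta>\<in>\<Delta>. real (n \<delta>) * (\<gamma> \<bullet> \<delta>))"
    by (simp only: inner_commute)
  have "\<exists>\<delta>\<in>\<Delta>. \<gamma> \<bullet> \<delta> \<noteq> 0"
    using eq_if_inner_simple[of \<gamma> 0] assms(3) zero_not_root by fastforce
  then obtain \<delta> where "\<delta> \<in> \<Delta>" "\<gamma> \<bullet> \<delta> \<noteq> 0" by blast
  then have "\<delta> \<in> \<Delta>" "real (n \<delta>) * (\<gamma> \<bullet> \<delta>) > 0" using assms(4)[of \<delta>] n(2)[of \<delta>] by auto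
  then show ?thesis unfolding eq
    by (intro sum_pos2[OF finite_simple, of \<delta>]) (use assms(4) in auto)
qed

text \<open>As \<gamma> - \<beta> is a nonnegative combination of simple roots, dominance of \<beta>
  gives \<beta> \<bullet> \<beta> \<le> \<beta> \<bullet> \<gamma>. If \<gamma> were no longer than
  \<beta>, Cauchy-Schwarz would make them equal.\<close>

lemma dominant_root_greater:
  assumes "\<beta> \<in> \<Phi>" "\<And>\<delta>. \<delta> \<in> \<Delta> \<Longrightarrow> \<beta> \<bullet> \<delta> \<ge> 0"
    and "\<gamma> \<in> \<Phi>" "\<And>\<delta>. \<delta> \<in> \<Delta> \<Longrightarrow> \<gamma> \<bullet> \<delta> \<ge> 0"
    and "lt \<beta> \<gamma>"
  shows "\<beta> \<bullet> \<beta> < \<gamma> \<bullet> \<gamma>"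
proof (rule ccontr)
  assume le: "\<not> ?thesis"
  have "\<gamma> - \<beta> \<in> \<Phi>"
    using diff_root[OF assms(3,1)] dominant_roots_inner_pos[OF assms(3,4,1,2)] assms(5) lt_irrefl by blast
  then have "\<gamma> - \<beta> \<in> positive_roots lt \<Phi>"
    using assms(5) lt_iff_diff[of \<beta> \<gamma>] by (auto simp: positive_roots_def)
  then obtain n :: "'a \<Rightarrow> nat" where n: "\<gamma> - \<beta> = (\<Sum>\<delta>\<in>\<Delta>. real (n \<delta>) *\<^sub>R \<delta>)"
    using pos_root_combination by blast
  have "0 \<le> (\<Sum>\<delta>\<in>\<Delta>. real (n \<delta>) * (\<beta> \<bullet> \<delta>))"
    by (rule sum_nonneg) (simp add: assms(2))
  also have "\<dots> = \<beta> \<bullet> (\<gamma> - \<beta>)" by (simp only: n inner_sum_right inner_scaleR_right)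
  finally have "\<beta> \<bullet> (\<gamma> - \<beta>) \<ge> 0" .
  then have "\<gamma> = \<beta>" using le by (intro eq_of_inner_eq) (auto simp: inner_diff inner_commute)
  then show False using assms(5) lt_irrefl by simp
qed

end

section \<open>The highest root: dominance, maximal length, uniqueness\<close>

context ordered_root_system
begin

text \<open>A negative inner product would let the reflection in \<delta> move \<beta> upwards
  inside \<open>S\<close>. The set is a parameter because it is taken both as \<Phi> and as the set
  of longest roots.\<close>

lemma greatest_dominant:
  assumes "\<beta> \<in> S" "\<And>x. x \<in> S \<Longrightarrow> x \<noteq> \<beta> \<Longrightarrow> lt x \<beta>" "\<delta> \<in> \<Delta>"
    and "\<beta> - (2 * (\<beta> \<bullet> \<delta>) / (\<delta> \<bullet> \<delta>)) *\<^sub>R \<delta> \<in> S"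
  shows "\<beta> \<bullet> \<delta> \<ge> 0"
proof (rule ccontr)
  assume neg: "\<not> ?thesis"
  define k where "k = - (2 * (\<beta> \<bullet> \<delta>) / (\<delta> \<bullet> \<delta>))"
  have "\<delta> \<bullet> \<delta> > 0" using assms simple_root root_inner_pos by blast
  then have "k > 0" using neg by (simp add: k_def divide_neg_pos)
  then have "lt 0 (k *\<^sub>R \<delta>)" using pos_scale simple_pos assms(3) by blast
  then have lt: "lt \<beta> (\<beta> + k *\<^sub>R \<delta>)" using lt_iff_diff[of \<beta> "\<beta> + k *\<^sub>R \<delta>"] by simp
  moreover have "\<beta> + k *\<^sub>R \<delta> \<in> S" using assms(4) by (simp add: k_def)
  ultimately show False using assms(2)[of "\<beta> + k *\<^sub>R \<delta>"] lt_trans lt_irrefl by metis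
qed

end

locale root_system_with_highest = irreducible_ordered_root_system +
  fixes \<psi>
  assumes highest: "highest_root lt \<Phi> \<psi>"
begin

lemma highest_mem: "\<psi> \<in> \<Phi>"
  and highest_greatest: "\<beta> \<in> \<Phi> \<Longrightarrow> \<beta> \<noteq> \<psi> \<Longrightarrow> lt \<beta> \<psi>"
  using highest by (auto simp: highest_root_def)

lemma highest_pos: "\<psi> \<bullet> \<psi> > 0"
  using highest_mem root_inner_pos by blast

lemma highest_dominant: "\<delta> \<in> \<Delta> \<Longrightarrow> \<psi> \<bullet> \<delta> \<ge> 0"
  by (rule greatest_dominant[OF highest_mem highest_greatest])
    (use reflection_root simple_root highest_mem in auto)

text \<open>The greatest of the longest roots is dominant, because reflections preserve length. Were
  it different from \<psi>, it would be the smaller of two dominant roots and hence strictly shorter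
  than \<psi>.\<close>

lemma highest_long:
  assumes "\<beta> \<in> \<Phi>"
  shows "\<beta> \<bullet> \<beta> \<le> \<psi> \<bullet> \<psi>"
proof -
  define m where "m = Max ((\<lambda>\<beta>. \<beta> \<bullet> \<beta>) ` \<Phi>)"
  have m: "\<beta> \<bullet> \<beta> \<le> m" if "\<beta> \<in> \<Phi>" for \<beta>
    using that finite_roots by (simp add: m_def)
  have "m \<in> (\<lambda>\<beta>. \<beta> \<bullet> \<beta>) ` \<Phi>"
    unfolding m_def by (rule Max_in) (use finite_roots highest_mem in auto)
  then have "{\<beta>\<in>\<Phi>. \<beta> \<bullet> \<beta> = m} \<noteq> {}" by auto
  then obtain \<gamma> where \<gamma>: "\<gamma> \<in> \<Phi>" "\<gamma> \<bullet> \<gamma> = m"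
    "\<forall>x\<in>{\<beta>\<in>\<Phi>. \<beta> \<bullet> \<beta> = m}. x \<noteq> \<gamma> \<longrightarrow> lt x \<gamma>"
    using finite_has_greatest[of "{\<beta>\<in>\<Phi>. \<beta> \<bullet> \<beta> = m}"] finite_roots by auto
  have "\<gamma> \<bullet> \<delta> \<ge> 0" if "\<delta> \<in> \<Delta>" for \<delta>
  proof (rule greatest_dominant[where S = "{\<beta>\<in>\<Phi>. \<beta> \<bullet> \<beta> = m}"])
    show "\<gamma> - (2 * (\<gamma> \<bullet> \<delta>) / (\<delta> \<bullet> \<delta>)) *\<^sub>R \<delta> \<in> {\<beta>\<in>\<Phi>. \<beta> \<bullet> \<beta> = m}"
      using reflection_root[OF simple_root[OF that] \<gamma>(1)] inner_reflection[of \<delta> \<gamma>]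
        simple_root[OF that] zero_not_root \<gamma>(2) by auto
  qed (use \<gamma> that in auto)
  then have "\<gamma> = \<psi>"
    using dominant_root_greater[OF \<gamma>(1) _ highest_mem highest_dominant]
      highest_greatest[OF \<gamma>(1)] m[OF highest_mem] \<gamma>(2) by force
  then show ?thesis using m[OF assms] \<gamma>(2) by simp
qed

lemma highest_eq_long_dominant:
  assumes "\<theta> \<in> \<Phi>" "\<And>\<delta>. \<delta> \<in> \<Delta> \<Longrightarrow> \<theta> \<bullet> \<delta> \<ge> 0" "\<psi> \<bullet> \<psi> \<le> \<theta> \<bullet> \<theta>"
  shows "\<psi> = \<theta>"
  using dominant_root_greater[OF assms(1,2) highest_mem highest_dominant]
    highest_greatest[OF assms(1)] assms(3) by force

lemma highest_combination:
  obtains n :: "'a \<Rightarrow> nat" where "\<psi> = (\<Sum>\<delta>\<in>\<Delta>. real (n \<delta>) *\<^sub>R \<delta>)" "\<And>\<delta>. \<delta> \<in> \<Delta> \<Longrightarrow> n \<delta> > 0"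
  using dominant_root_combination[OF highest_mem highest_dominant] by blast

lemma root_d_eqI:
  assumes "x \<in> alcove_face lt \<Phi> \<psi>" "x \<bullet> x = r"
    and "\<And>x. x \<in> alcove_face lt \<Phi> \<psi> \<Longrightarrow> x \<bullet> x \<le> r"
  shows "root_d lt \<Phi> \<psi> = sqrt r"
  unfolding root_d_def by (rule Greatest_equality) (use assms in auto)

text \<open>Every coefficient of \<psi> is at least 1, so x \<bullet> \<psi> = 1 confines each x
  \<bullet> \<delta> to [0, 1]; as the simple roots span, this bounds all coordinates of x.\<close>

lemma compact_alcove_face: "compact (alcove_face lt \<Phi> \<psi>)"
proof -
  obtain n :: "'a \<Rightarrow> nat" where n: "\<psi> = (\<Sum>\<delta>\<in>\<Delta>. real (n \<delta>) *\<^sub>R \<delta>)" "\<And>\<delta>. \<delta> \<in> \<Delta> \<Longrightarrow> n \<delta> > 0"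
    using highest_combination by blast
  have le1: "\<bar>x \<bullet> \<delta>\<bar> \<le> 1" if x: "x \<in> alcove_face lt \<Phi> \<psi>" and \<delta>: "\<delta> \<in> \<Delta>" for x \<delta>
  proof -
    have nonneg: "x \<bullet> \<epsilon> \<ge> 0" if "\<epsilon> \<in> \<Delta>" for \<epsilon> using x that by (simp add: alcove_face_def)
    have "1 * (x \<bullet> \<delta>) \<le> real (n \<delta>) * (x \<bullet> \<delta>)"
      using n(2)[OF \<delta>] nonneg[OF \<delta>] by (intro mult_right_mono) auto
    also have "\<dots> \<le> (\<Sum>\<epsilon>\<in>\<Delta>. real (n \<epsilon>) * (x \<bullet> \<epsilon>))"
      using \<delta> finite_simple nonneg by (intro member_le_sum) auto
    also have "\<dots> = x \<bullet> \<psi>" by (subst n(1)) (simp add: inner_sum_right)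
    also have "\<dots> = 1" using x by (simp add: alcove_face_def)
    finally show ?thesis using nonneg[OF \<delta>] by simp
  qed
  have "\<exists>c. b = (\<Sum>\<delta>\<in>\<Delta>. c \<delta> *\<^sub>R \<delta>)" for b
    using span_simple span_finite[OF finite_simple] by (metis (no_types, lifting) UNIV_I imageE)
  then obtain c where c: "\<And>b. b = (\<Sum>\<delta>\<in>\<Delta>. c b \<delta> *\<^sub>R \<delta>)" by metis
  have "norm x \<le> (\<Sum>b\<in>Basis. \<Sum>\<delta>\<in>\<Delta>. \<bar>c b \<delta>\<bar>)" if x: "x \<in> alcove_face lt \<Phi> \<psi>" for x
  proof -
    have "norm x \<le> (\<Sum>b\<in>Basis. \<bar>x \<bullet> b\<bar>)" by (rule norm_le_l1)
    also have "\<dots> \<le> (\<Sum>b\<in>Basis. \<Sum>\<delta>\<in>\<Delta>. \<bar>c b \<delta>\<bar>)"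
    proof (rule sum_mono)
      fix b :: 'a
      have "\<bar>x \<bullet> b\<bar> = \<bar>\<Sum>\<delta>\<in>\<Delta>. c b \<delta> * (x \<bullet> \<delta>)\<bar>" by (subst c[of b]) (simp add: inner_sum_right)
      also have "\<dots> \<le> (\<Sum>\<delta>\<in>\<Delta>. \<bar>c b \<delta>\<bar>)"
        by (rule order_trans[OF sum_abs sum_mono])
          (use le1[OF x] in \<open>auto simp: abs_mult intro: mult_left_le\<close>)
      finally show "\<bar>x \<bullet> b\<bar> \<le> (\<Sum>\<delta>\<in>\<Delta>. \<bar>c b \<delta>\<bar>)" .
    qed
    finally show ?thesis .
  qed
  then have "bounded (alcove_face lt \<Phi> \<psi>)" by (auto simp: bounded_iff)
  moreover have "alcove_face lt \<Phi> \<psi> = (\<Inter>\<delta>\<in>\<Delta>. {x. x \<bullet> \<delta> \<ge> 0}) \<inter> {x. x \<bullet> \<psi> = 1}"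
    by (auto simp: alcove_face_def)
  then have "closed (alcove_face lt \<Phi> \<psi>)"
    by (auto intro!: closed_INT closed_Collect_le closed_Collect_eq continuous_intros)
  ultimately show ?thesis by (simp add: compact_eq_bounded_closed)
qed

lemma root_d_attained:
  shows "\<exists>x\<in>alcove_face lt \<Phi> \<psi>. sqrt (x \<bullet> x) = root_d lt \<Phi> \<psi>"
    and "\<forall>x\<in>alcove_face lt \<Phi> \<psi>. sqrt (x \<bullet> x) \<le> root_d lt \<Phi> \<psi>"
proof -
  \<comment> \<open>\<psi> is dominant, so its multiple on the hyperplane x \<bullet> \<psi> = 1
    shows that the face is nonempty.\<close>
  have "(1 / (\<psi> \<bullet> \<psi>)) *\<^sub>R \<psi> \<in> alcove_face lt \<Phi> \<psi>"
    using highest_pos highest_dominant by (auto simp: alcove_face_def)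
  then have "alcove_face lt \<Phi> \<psi> \<noteq> {}" by blast
  moreover have "continuous_on (alcove_face lt \<Phi> \<psi>) (\<lambda>x. x \<bullet> x)"
    by (intro continuous_intros)
  ultimately have "\<exists>x\<in>alcove_face lt \<Phi> \<psi>. \<forall>y\<in>alcove_face lt \<Phi> \<psi>. y \<bullet> y \<le> x \<bullet> x"
    by (rule continuous_attains_sup[OF compact_alcove_face])
  then obtain x where x: "x \<in> alcove_face lt \<Phi> \<psi>" "\<forall>y\<in>alcove_face lt \<Phi> \<psi>. y \<bullet> y \<le> x \<bullet> x"
    by blast
  then have "root_d lt \<Phi> \<psi> = sqrt (x \<bullet> x)" by (intro root_d_eqI) auto
  with x show "\<exists>x\<in>alcove_face lt \<Phi> \<psi>. sqrt (x \<bullet> x) = root_d lt \<Phi> \<psi>"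
    "\<forall>x\<in>alcove_face lt \<Phi> \<psi>. sqrt (x \<bullet> x) \<le> root_d lt \<Phi> \<psi>" by auto
qed

end

section \<open>Maximal norms from orthogonal frames and vertices\<close>

text \<open>Parseval's identity for an orthogonal basis with common squared length \<open>s\<close>;
  keeping \<open>s\<close> free avoids normalising the roots.\<close>

lemma orthogonal_frame_norm:
  fixes e :: "nat \<Rightarrow> 'a::euclidean_space"
  assumes orth: "\<And>i j. i \<in> {1..l} \<Longrightarrow> j \<in> {1..l} \<Longrightarrow> e i \<bullet> e j = (if i = j then s else 0)"
    and s: "s > 0" and span: "span (e ` {1..l}) = UNIV"
  shows "x \<bullet> x = (\<Sum>i=1..l. (x \<bullet> e i)\<^sup>2) / s"
proof -
  define y where "y = (\<Sum>i=1..l. ((x \<bullet> e i) / s) *\<^sub>R e i)"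
  have y: "y \<bullet> e j = x \<bullet> e j" if "j \<in> {1..l}" for j
  proof -
    have "y \<bullet> e j = (\<Sum>i=1..l. (x \<bullet> e i) / s * (e i \<bullet> e j))"
      by (simp add: y_def inner_sum_left)
    also have "\<dots> = (\<Sum>i=1..l. if i = j then x \<bullet> e i else 0)"
      using that s by (intro sum.cong) (auto simp: orth)
    finally show ?thesis using that by simp
  qed
  have "orthogonal (x - y) z" for z
    by (rule orthogonal_to_span[where S = "e ` {1..l}"])
      (use span y in \<open>auto simp: orthogonal_def inner_diff\<close>)
  then have "(x - y) \<bullet> (x - y) = 0" unfolding orthogonal_def by blast
  then have "x = y" by simp
  then have "x \<bullet> x = x \<bullet> y" by simp
  also have "\<dots> = (\<Sum>i=1..l. (x \<bullet> e i)\<^sup>2) / s"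
    by (simp add: y_def inner_sum_right power2_eq_square sum_divide_distrib)
  finally show ?thesis .
qed

context root_system_with_highest
begin

text \<open>The Cartan integer is -1, so the reflection adds \<alpha> exactly once.\<close>

lemma add_root_if_inner:
  assumes "\<alpha> \<in> \<Phi>" "\<beta> \<in> \<Phi>" "\<alpha> \<bullet> \<beta> = - (\<alpha> \<bullet> \<alpha>) / 2"
  shows "\<beta> + \<alpha> \<in> \<Phi>"
  using reflection_root[OF assms(1,2)] assms(3) root_inner_pos[OF assms(1)]
  by (simp add: inner_commute)

text \<open>Here \<psi> = 2 e_1, so the coordinates y_i = y \<bullet> e_i of a point of the face
  satisfy 1/2 = y_1 \<ge> ... \<ge> y_l \<ge> 0, and the norm is largest when all of them are 1/2.
  The last simple root is 2 e_l in type C and e_l in type BC; the factor \<open>c\<close> covers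
  both.\<close>

lemma root_d_frame_C:
  fixes e :: "nat \<Rightarrow> 'a"
  assumes l: "l \<ge> 1" and s: "s > 0" and c: "c > 0"
    and orth: "\<And>i j. i \<in> {1..l} \<Longrightarrow> j \<in> {1..l} \<Longrightarrow> e i \<bullet> e j = (if i = j then s else 0)"
    and simple: "\<Delta> = insert (c *\<^sub>R e l) ((\<lambda>i. e i - e (Suc i)) ` {1..<l})"
    and double: "2 *\<^sub>R e l \<in> \<Phi>"
    and long: "\<psi> \<bullet> \<psi> \<le> 4 * s"
  shows "root_d lt \<Phi> \<psi> = sqrt (real l / (\<psi> \<bullet> \<psi>))"
proof -
  have diff: "e i - e (Suc i) \<in> \<Delta>" if "i \<in> {1..<l}" for i using simple that by auto
  have "e i \<in> span (e ` {1..l})" if "i \<in> {1..l}" for i using that by (intro span_base) auto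
  then have "span \<Delta> \<subseteq> span (e ` {1..l})"
    unfolding simple using l by (intro span_minimal) (auto intro: span_scale span_diff)
  then have span: "span (e ` {1..l}) = UNIV" using span_simple by auto
  \<comment> \<open>Downwards from l: the reflection in e_n - e_(n+1) carries 2 e_(n+1) to 2
    e_n.\<close>
  have "2 *\<^sub>R e k \<in> \<Phi>" if "1 \<le> k" "k \<le> l" for k
    using that(2,1)
  proof (induction rule: inc_induct)
    case (step n)
    define \<alpha> where "\<alpha> = e n - e (Suc n)"
    have "\<alpha> \<in> \<Phi>" using step diff[of n] simple_root by (auto simp: \<alpha>_def)
    then have "2 *\<^sub>R e (Suc n) - (2 * ((2 *\<^sub>R e (Suc n)) \<bullet> \<alpha>) / (\<alpha> \<bullet> \<alpha>)) *\<^sub>R \<alpha> \<in> \<Phi>"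
      using step by (intro reflection_root) auto
    moreover have "2 * ((2 *\<^sub>R e (Suc n)) \<bullet> \<alpha>) / (\<alpha> \<bullet> \<alpha>) = - 2"
      using step orth s by (simp add: \<alpha>_def inner_diff)
    ultimately show ?case by (simp add: \<alpha>_def algebra_simps)
  qed (use double in auto)
  then have "2 *\<^sub>R e 1 \<in> \<Phi>" using l by simp
  moreover have "(2 *\<^sub>R e 1) \<bullet> \<delta> \<ge> 0" if "\<delta> \<in> \<Delta>" for \<delta>
    using that s c orth l unfolding simple by (auto simp: inner_diff)
  moreover have "(2 *\<^sub>R e 1) \<bullet> (2 *\<^sub>R e 1) = 4 * s" using orth l by simp
  ultimately have \<psi>: "\<psi> = 2 *\<^sub>R e 1" "\<psi> \<bullet> \<psi> = 4 * s"
    using highest_eq_long_dominant[of "2 *\<^sub>R e 1"] long by auto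
  define x where "x = (1 / (2 * s)) *\<^sub>R (\<Sum>i=1..l. e i)"
  have x: "x \<bullet> e j = 1 / 2" if "j \<in> {1..l}" for j
  proof -
    have "(\<Sum>i=1..l. e i \<bullet> e j) = (\<Sum>i=1..l. if i = j then s else 0)"
      using that by (intro sum.cong) (auto simp: orth)
    then show ?thesis using that s by (simp add: x_def inner_sum_left)
  qed
  have "root_d lt \<Phi> \<psi> = sqrt (real l / 4 / s)"
  proof (rule root_d_eqI)
    show "x \<in> alcove_face lt \<Phi> \<psi>"
      using l c by (auto simp: x alcove_face_def simple \<psi> inner_diff)
    show "x \<bullet> x = real l / 4 / s"
      by (subst orthogonal_frame_norm[OF orth s span]) (simp_all add: x power2_eq_square)
  next
    fix y assume "y \<in> alcove_face lt \<Phi> \<psi>"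
    then have y: "\<And>i. i \<in> {1..<l} \<Longrightarrow> y \<bullet> e (Suc i) \<le> y \<bullet> e i" "y \<bullet> e l \<ge> 0" "y \<bullet> e 1 = 1 / 2"
      using c by (auto simp: alcove_face_def simple \<psi> inner_diff zero_le_mult_iff)
    have up: "y \<bullet> e k \<le> 1 / 2" if "1 \<le> k" "k \<le> l" for k
      using that
    proof (induction rule: dec_induct)
      case (step n)
      then show ?case using y(1)[of n] by auto
    qed (use y in auto)
    have down: "y \<bullet> e k \<ge> 0" if "1 \<le> k" "k \<le> l" for k
      using that(2,1)
    proof (induction rule: inc_induct)
      case (step n)
      then show ?case using y(1)[of n] by auto
    qed (use y in auto)
    have "(\<Sum>i=1..l. (y \<bullet> e i)\<^sup>2) \<le> (\<Sum>i=1..l. (1 / 2)\<^sup>2)"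
      using up down by (intro sum_mono power_mono) auto
    then have "(\<Sum>i=1..l. (y \<bullet> e i)\<^sup>2) \<le> real l / 4" by (simp add: power2_eq_square)
    then have "(\<Sum>i=1..l. (y \<bullet> e i)\<^sup>2) / s \<le> real l / 4 / s"
      using s by (intro divide_right_mono) auto
    then show "y \<bullet> y \<le> real l / 4 / s"
      by (subst orthogonal_frame_norm[OF orth s span])
  qed
  then show ?thesis using \<psi>(2) by simp
qed

text \<open>Here \<psi> = e_1 + e_2. With t = y_2 a point of the face has y_1 = 1 - t, |y_k| \<le> t
  for k \<ge> 2, and 0 \<le> t \<le> 1/2. Hence s times its squared norm is at most 1 - 2t + l t^2,
  which is convex with endpoint values 1 and l/4; they are attained at e_1 / s and at the point with
  all coordinates 1/2. The root \<mu> is e_l in type B and e_(l-1) + e_l in type D.\<close>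

lemma root_d_frame_BD:
  fixes e :: "nat \<Rightarrow> 'a"
  assumes l: "l \<ge> 2" and s: "s > 0"
    and orth: "\<And>i j. i \<in> {1..l} \<Longrightarrow> j \<in> {1..l} \<Longrightarrow> e i \<bullet> e j = (if i = j then s else 0)"
    and simple: "\<Delta> = insert \<mu> ((\<lambda>i. e i - e (Suc i)) ` {1..<l})"
    and last: "\<mu> = e l \<or> \<mu> = e (l - 1) + e l \<and> l \<ge> 3"
    and sum: "e (l - 1) + e l \<in> \<Phi>"
    and long: "\<psi> \<bullet> \<psi> \<le> 2 * s"
  shows "root_d lt \<Phi> \<psi> = sqrt (max 1 (real l / 4) * 2 / (\<psi> \<bullet> \<psi>))"
proof -
  have diff: "e i - e (Suc i) \<in> \<Delta>" if "i \<in> {1..<l}" for i using simple that by auto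
  have "e i \<in> span (e ` {1..l})" if "i \<in> {1..l}" for i using that by (intro span_base) auto
  then have "span \<Delta> \<subseteq> span (e ` {1..l})"
    unfolding simple using l last by (intro span_minimal) (auto intro: span_add span_diff)
  then have span: "span (e ` {1..l}) = UNIV" using span_simple by auto
  \<comment> \<open>Adding the simple root e_n - e_(n+1) lowers one index. The chain leads from
    e_(l-1) + e_l to e_1 + e_l and from there to e_1 + e_2.\<close>
  have swap: "e k + e n \<in> \<Phi>"
    if "e k + e (Suc n) \<in> \<Phi>" "n \<in> {1..<l}" "k \<in> {1..l}" "k \<noteq> n" "k \<noteq> Suc n" for k n
  proof -
    have "(e k + e (Suc n)) + (e n - e (Suc n)) \<in> \<Phi>"
      by (rule add_root_if_inner) (use that diff simple_root orth in \<open>auto simp: inner_diff inner_add\<close>)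
    then show ?thesis by simp
  qed
  have 1: "e l + e k \<in> \<Phi>" if "1 \<le> k" "k \<le> l - 1" for k
    using that(2,1)
  proof (induction rule: inc_induct)
    case (step n)
    then show ?case by - (rule swap, auto)
  qed (use sum in \<open>simp add: add.commute\<close>)
  have 2: "e 1 + e k \<in> \<Phi>" if "2 \<le> k" "k \<le> l" for k
    using that(2,1)
  proof (induction rule: inc_induct)
    case base
    then show ?case using 1[of 1] l by (simp add: add.commute)
  next
    case (step n)
    then show ?case by - (rule swap, auto)
  qed
  have "e 1 + e 2 \<in> \<Phi>" using 2 l by simp
  moreover have "(e 1 + e 2) \<bullet> \<delta> \<ge> 0" if "\<delta> \<in> \<Delta>" for \<delta>
    using that s orth l last unfolding simple by (auto simp: inner_diff inner_add)
  moreover have "(e 1 + e 2) \<bullet> (e 1 + e 2) = 2 * s" using orth l by (simp add: inner_add)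
  ultimately have \<psi>: "\<psi> = e 1 + e 2" "\<psi> \<bullet> \<psi> = 2 * s"
    using highest_eq_long_dominant[of "e 1 + e 2"] long by auto
  define r where "r = max 1 (real l / 4) / s"
  have "\<exists>x\<in>alcove_face lt \<Phi> \<psi>. x \<bullet> x = r"
  proof (cases "l \<le> 4")
    case True
    then have "(1 / s) *\<^sub>R e 1 \<in> alcove_face lt \<Phi> \<psi>"
      using l s orth last by (auto simp: alcove_face_def simple \<psi> inner_diff inner_add)
    moreover have "((1 / s) *\<^sub>R e 1) \<bullet> ((1 / s) *\<^sub>R e 1) = r"
      using True l s orth by (simp add: r_def)
    ultimately show ?thesis by blast
  next
    case False
    define x where "x = (1 / (2 * s)) *\<^sub>R (\<Sum>i=1..l. e i)"
    have x: "x \<bullet> e j = 1 / 2" if "j \<in> {1..l}" for j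
    proof -
      have "(\<Sum>i=1..l. e i \<bullet> e j) = (\<Sum>i=1..l. if i = j then s else 0)"
        using that by (intro sum.cong) (auto simp: orth)
      then show ?thesis using that s by (simp add: x_def inner_sum_left)
    qed
    have "x \<in> alcove_face lt \<Phi> \<psi>"
      using l last by (auto simp: x alcove_face_def simple \<psi> inner_diff inner_add)
    moreover have "x \<bullet> x = r"
      by (subst orthogonal_frame_norm[OF orth s span])
        (use False in \<open>simp_all add: x power2_eq_square r_def\<close>)
    ultimately show ?thesis by blast
  qed
  then obtain x where x: "x \<in> alcove_face lt \<Phi> \<psi>" "x \<bullet> x = r" by blast
  have "root_d lt \<Phi> \<psi> = sqrt r"
  proof (rule root_d_eqI[OF x])
    fix y assume y': "y \<in> alcove_face lt \<Phi> \<psi>"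
    then have y: "\<And>i. i \<in> {1..<l} \<Longrightarrow> y \<bullet> e (Suc i) \<le> y \<bullet> e i" "y \<bullet> e 1 + y \<bullet> e 2 = 1"
      by (auto simp: alcove_face_def simple \<psi> inner_diff inner_add)
    define t where "t = y \<bullet> e 2"
    have up: "y \<bullet> e k \<le> t" if "2 \<le> k" "k \<le> l" for k
      using that
    proof (induction rule: dec_induct)
      case (step n)
      then show ?case using y(1)[of n] by auto
    qed (auto simp: t_def)
    have "y \<bullet> \<mu> \<ge> 0" using y' by (simp add: alcove_face_def simple)
    moreover have "y \<bullet> e l \<le> y \<bullet> e (l - 1)" "y \<bullet> e l \<le> t"
      using y(1)[of "l - 1"] up[of l] l by auto
    moreover have "y \<bullet> e (l - 1) \<le> t" if "l \<ge> 3" using up[of "l - 1"] that by simp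
    \<comment> \<open>In type D the last coordinate may be negative, but y \<bullet> \<mu> \<ge> 0
      bounds it below by - y_(l-1), hence by - t. In type B it is nonnegative.\<close>
    ultimately have low: "y \<bullet> e l \<ge> - t" "l \<ge> 3 \<Longrightarrow> y \<bullet> e (l - 1) \<ge> 0" "t \<ge> 0"
      using last by (force simp: inner_add)+
    have down: "y \<bullet> e k \<ge> 0" if "2 \<le> k" "k \<le> l - 1" for k
      using that(2,1)
    proof (induction rule: inc_induct)
      case (step n)
      then have "n \<in> {1..<l}" by auto
      with step show ?case using y(1)[of n] by auto
    qed (use low in auto)
    have abs: "\<bar>y \<bullet> e k\<bar> \<le> \<bar>t\<bar>" if "k \<in> {2..l}" for k
      using that up[of k] down[of k] low by (cases "k = l") auto
    have t: "0 \<le> t" "t \<le> 1 / 2" using low y(1)[of 1] y(2) l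
      by (auto simp: t_def numeral_2_eq_2)
    have "(\<Sum>i=1..l. (y \<bullet> e i)\<^sup>2) = (y \<bullet> e 1)\<^sup>2 + (\<Sum>i=2..l. (y \<bullet> e i)\<^sup>2)"
      using l by (simp add: sum.atLeast_Suc_atMost numeral_2_eq_2)
    also have "(\<Sum>i=2..l. (y \<bullet> e i)\<^sup>2) \<le> (\<Sum>i=2..l. t\<^sup>2)"
      using abs by (intro sum_mono) (simp add: abs_le_square_iff)
    also have "(y \<bullet> e 1)\<^sup>2 + (\<Sum>i=2..l. t\<^sup>2) = 1 - 2 * t + l * t\<^sup>2"
    proof -
      have y1: "y \<bullet> e 1 = 1 - t" using y(2) by (simp add: t_def)
      show ?thesis using l unfolding y1 by (simp add: of_nat_diff power2_eq_square algebra_simps)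
    qed
    \<comment> \<open>Up to l = 4 the excess over 1 is t (l t - 2); beyond that the gap to l/4 is (1
      - 2t) (l (1 + 2t) / 4 - 1).\<close>
    also have "\<dots> \<le> max 1 (real l / 4)"
    proof (cases "l \<le> 4")
      case True
      have "l * t \<le> 4 * (1 / 2)" using True t by (intro mult_mono) auto
      then have "(l * t - 2) * t \<le> 0" using t by (intro mult_nonpos_nonneg) auto
      then show ?thesis by (simp add: power2_eq_square algebra_simps)
    next
      case False
      have "4 * 1 \<le> l * (1 + 2 * t)" using False t by (intro mult_mono) auto
      then have "0 \<le> (1 - 2 * t) * (l * (1 + 2 * t) / 4 - 1)" using t by (intro mult_nonneg_nonneg) auto
      then have "1 - 2 * t + l * t\<^sup>2 \<le> real l / 4" by (simp add: power2_eq_square field_simps)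
      then show ?thesis by simp
    qed
    finally show "y \<bullet> y \<le> r"
      by (subst orthogonal_frame_norm[OF orth s span])
        (use s in \<open>auto simp: r_def intro!: divide_right_mono\<close>)
  qed
  then show ?thesis using \<psi>(2) s by (simp add: r_def)
qed

text \<open>Convexity enters only as the triangle inequality: x is expanded in the dual basis, each
  \<omega>_i has norm at most sqrt r times m_i, and the weights (x \<bullet> \<alpha>_i) m_i add up
  to x \<bullet> \<psi> = 1. At index \<open>k\<close> the bound is an equality.\<close>

lemma root_d_vertices:
  fixes \<omega> \<alpha> :: "nat \<Rightarrow> 'a" and m :: "nat \<Rightarrow> real"
  assumes bij: "bij_betw \<alpha> I \<Delta>"
    and dual: "\<And>i j. i \<in> I \<Longrightarrow> j \<in> I \<Longrightarrow> \<omega> i \<bullet> \<alpha> j = (if i = j then 1 else 0)"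
    and \<psi>: "\<psi> = (\<Sum>i\<in>I. m i *\<^sub>R \<alpha> i)" and m: "\<And>i. i \<in> I \<Longrightarrow> m i > 0"
    and bound: "\<And>i. i \<in> I \<Longrightarrow> \<omega> i \<bullet> \<omega> i \<le> r * (m i)\<^sup>2"
    and k: "k \<in> I" "\<omega> k \<bullet> \<omega> k = r * (m k)\<^sup>2"
  shows "root_d lt \<Phi> \<psi> = sqrt r"
proof -
  have I: "\<Delta> = \<alpha> ` I" "finite I" "inj_on \<alpha> I"
    using bij finite_simple bij_betw_finite by (auto simp: bij_betw_def)
  have r: "r \<ge> 0"
    using k m[OF k(1)] inner_ge_zero[of "\<omega> k"] by (simp add: zero_le_mult_iff)
  show ?thesis
  proof (rule root_d_eqI)
    have "\<omega> k \<bullet> \<psi> = (\<Sum>i\<in>I. if i = k then m i else 0)"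
      unfolding \<psi> inner_sum_right by (intro sum.cong) (use dual k in auto)
    then have "\<omega> k \<bullet> \<psi> = m k" using k I by simp
    then show "(1 / m k) *\<^sub>R \<omega> k \<in> alcove_face lt \<Phi> \<psi>"
      using m[OF k(1)] k dual by (auto simp: alcove_face_def I)
    show "((1 / m k) *\<^sub>R \<omega> k) \<bullet> ((1 / m k) *\<^sub>R \<omega> k) = r"
      using m[OF k(1)] k(2) by (simp add: power2_eq_square)
  next
    fix x assume "x \<in> alcove_face lt \<Phi> \<psi>"
    then have x: "\<And>i. i \<in> I \<Longrightarrow> x \<bullet> \<alpha> i \<ge> 0" "x \<bullet> \<psi> = 1" by (auto simp: alcove_face_def I)
    have "x = (\<Sum>i\<in>I. (x \<bullet> \<alpha> i) *\<^sub>R \<omega> i)"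
    proof (rule eq_if_inner_simple)
      fix \<delta> assume "\<delta> \<in> \<Delta>"
      then obtain j where j: "j \<in> I" "\<delta> = \<alpha> j" using I by auto
      have "(\<Sum>i\<in>I. (x \<bullet> \<alpha> i) *\<^sub>R \<omega> i) \<bullet> \<delta> = (\<Sum>i\<in>I. if i = j then x \<bullet> \<alpha> i else 0)"
        unfolding j inner_sum_left by (intro sum.cong) (use dual j in auto)
      then show "x \<bullet> \<delta> = (\<Sum>i\<in>I. (x \<bullet> \<alpha> i) *\<^sub>R \<omega> i) \<bullet> \<delta>" using j I by simp
    qed
    then have "norm x \<le> (\<Sum>i\<in>I. norm ((x \<bullet> \<alpha> i) *\<^sub>R \<omega> i))" by (metis norm_sum)
    also have "\<dots> \<le> (\<Sum>i\<in>I. (x \<bullet> \<alpha> i) * (sqrt r * m i))"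
    proof (rule sum_mono)
      fix i assume i: "i \<in> I"
      have "norm (\<omega> i) \<le> sqrt (r * (m i)\<^sup>2)"
        unfolding norm_eq_sqrt_inner using bound[OF i] by simp
      also have "\<dots> = sqrt r * m i" using m[OF i] by (simp add: real_sqrt_mult)
      finally show "norm ((x \<bullet> \<alpha> i) *\<^sub>R \<omega> i) \<le> (x \<bullet> \<alpha> i) * (sqrt r * m i)"
        using x(1)[OF i] by (simp add: mult_left_mono)
    qed
    also have "\<dots> = sqrt r * (x \<bullet> \<psi>)"
      by (simp add: \<psi> inner_sum_right sum_distrib_left mult_ac)
    finally have "norm x \<le> sqrt r" using x(2) by simp
    then have "(norm x)\<^sup>2 \<le> (sqrt r)\<^sup>2" by (intro power_mono) auto
    then show "x \<bullet> x \<le> r" using r by (simp add: power2_norm_eq_inner)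
  qed
qed

end

section \<open>Types B, C, D and BC\<close>

text \<open>Telescoping sums recover the e_i from their differences and the last vector
  \<open>u\<close>. Only the path of the first l - 1 roots is prescribed; the double bond or fork at
  the end enters through \<open>u\<close> alone.\<close>

lemma path_frame:
  fixes \<alpha> :: "nat \<Rightarrow> 'a::euclidean_space"
  assumes gram: "\<And>i j. i \<in> {1..<l} \<Longrightarrow> j \<in> {1..<l} \<Longrightarrow>
      \<alpha> i \<bullet> \<alpha> j = (if i = j then 2 * s else if i = Suc j \<or> j = Suc i then - s else 0)"
    and u: "u \<bullet> u = s" "\<And>j. j \<in> {1..<l} \<Longrightarrow> u \<bullet> \<alpha> j = (if Suc j = l then - s else 0)"
  obtains e :: "nat \<Rightarrow> 'a" where
    "\<And>i j. i \<in> {1..l} \<Longrightarrow> j \<in> {1..l} \<Longrightarrow> e i \<bullet> e j = (if i = j then s else 0)"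
    and "e l = u" and "\<And>i. i \<in> {1..<l} \<Longrightarrow> e i - e (Suc i) = \<alpha> i"
proof -
  define e where "e i = u + (\<Sum>j=i..<l. \<alpha> j)" for i
  have el: "e l = u" by (simp add: e_def)
  have unfold: "e i = \<alpha> i + e (Suc i)" if "i < l" for i
    using that by (simp add: e_def sum.atLeast_Suc_lessThan)
  have e\<alpha>: "e i \<bullet> \<alpha> j = (if j = i then s else if Suc j = i then - s else 0)"
    if "1 \<le> i" "i \<le> l" "j \<in> {1..<l}" for i j
    using that(2,1)
  proof (induction rule: inc_induct)
    case base
    then show ?case using u(2)[of j] that(3) by (auto simp: el)
  next
    case (step n)
    then show ?case using that(3) by (auto simp: unfold inner_add_left gram)
  qed
  have eu: "e i \<bullet> u = (if i = l then s else 0)" if "1 \<le> i" "i \<le> l" for i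
    using that(2,1)
  proof (induction rule: inc_induct)
    case base
    then show ?case using u(1) by (simp add: el)
  next
    case (step n)
    then show ?case using u(2)[of n] that(1)
      by (auto simp: unfold inner_add_left inner_commute[of "\<alpha> n"])
  qed
  have "e i \<bullet> e k = (if i = k then s else 0)" if "1 \<le> k" "k \<le> l" "i \<in> {1..l}" for i k
    using that(2,1)
  proof (induction rule: inc_induct)
    case base
    then show ?case using eu[of i] that(3) by (auto simp: el)
  next
    case (step n)
    have "e i \<bullet> e n = e i \<bullet> \<alpha> n + e i \<bullet> e (Suc n)"
      using step.hyps unfold[of n] by (simp add: inner_add_right)
    then show ?case using step that(3) e\<alpha>[of i n] by auto
  qed
  then show ?thesis using el unfold by (intro that[of e]) auto
qed

lemma constant_on_interval:
  fixes f :: "nat \<Rightarrow> 'b"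
  assumes "\<And>i. a \<le> i \<Longrightarrow> i < b \<Longrightarrow> f i = f (Suc i)" "a \<le> i" "i \<le> b"
  shows "f i = f b"
  using assms(3,2) by (induction rule: inc_induct) (auto simp: assms(1))

section \<open>Simple roots numbered by a Cartan matrix\<close>

context root_system_with_highest
begin

text \<open>In contrast to \<open>has_type\<close>, reducedness is left out, so that a nonreduced
  \<Phi> can carry a basis of type B.\<close>

definition cartan_basis :: "cartan_type \<Rightarrow> (nat \<Rightarrow> 'a) \<Rightarrow> bool" where
  "cartan_basis X \<alpha> \<longleftrightarrow> bij_betw \<alpha> {1..cartan_rank X} \<Delta> \<and>
     (\<forall>i\<in>{1..cartan_rank X}. \<forall>j\<in>{1..cartan_rank X}.
        2 * (\<alpha> i \<bullet> \<alpha> j) / (\<alpha> j \<bullet> \<alpha> j) = real_of_int (cartan_matrix X i j))"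

context
  fixes X \<alpha>
  assumes basis: "cartan_basis X \<alpha>"
begin

lemma basis_image: "\<Delta> = \<alpha> ` {1..cartan_rank X}"
  using basis by (auto simp: cartan_basis_def bij_betw_def)

lemma basis_pos: "i \<in> {1..cartan_rank X} \<Longrightarrow> \<alpha> i \<bullet> \<alpha> i > 0"
  using basis_image simple_root root_inner_pos by blast

lemma basis_gram:
  assumes "i \<in> {1..cartan_rank X}" "j \<in> {1..cartan_rank X}"
  shows "\<alpha> i \<bullet> \<alpha> j = real_of_int (cartan_matrix X i j) * (\<alpha> j \<bullet> \<alpha> j) / 2"
proof -
  have "2 * (\<alpha> i \<bullet> \<alpha> j) / (\<alpha> j \<bullet> \<alpha> j) = real_of_int (cartan_matrix X i j)"
    using basis assms unfolding cartan_basis_def by blast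
  then show ?thesis using basis_pos[OF assms(2)] by (simp add: field_simps)
qed

text \<open>Symmetry of the inner product turns two transposed Cartan entries into a ratio of
  squared lengths; in a connected diagram one length thus determines all.\<close>

lemma basis_norms:
  assumes "i \<in> {1..cartan_rank X}" "j \<in> {1..cartan_rank X}"
  shows "real_of_int (cartan_matrix X i j) * (\<alpha> j \<bullet> \<alpha> j) = real_of_int (cartan_matrix X j i) * (\<alpha> i \<bullet> \<alpha> i)"
  using basis_gram[OF assms] basis_gram[OF assms(2,1)] by (simp add: inner_commute)

end

lemma reduced_root_length:
  assumes "reduced_roots \<Phi>" "\<beta> \<in> \<Phi>"
  obtains \<delta> where "\<delta> \<in> \<Delta>" "\<beta> \<bullet> \<beta> = \<delta> \<bullet> \<delta>"
proof -
  obtain \<delta> c where "\<delta> \<in> \<Delta>" "c = 1 \<or> c = (2::real)" "c *\<^sub>R \<delta> \<in> \<Phi>" "\<beta> \<bullet> \<beta> = c\<^sup>2 * (\<delta> \<bullet> \<delta>)"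
    using root_length[OF assms(2)] by blast
  moreover from this have "c = 1 \<or> c = -1"
    using assms(1) simple_root unfolding reduced_roots_def by blast
  ultimately show ?thesis by (intro that[of \<delta>]) auto
qed

text \<open>The short simple root is the last frame vector. Type B and type BC both start from this
  frame, the latter also in rank 1.\<close>

lemma type_B_frame:
  assumes basis: "cartan_basis (Type_B l) \<alpha>" and l: "l \<ge> 1"
  obtains e :: "nat \<Rightarrow> 'a" and s where "s > 0"
    and "\<And>i j. i \<in> {1..l} \<Longrightarrow> j \<in> {1..l} \<Longrightarrow> e i \<bullet> e j = (if i = j then s else 0)"
    and "\<Delta> = insert (e l) ((\<lambda>i. e i - e (Suc i)) ` {1..<l})"
proof -
  define s where "s = \<alpha> l \<bullet> \<alpha> l"
  note gram = basis_gram[OF basis, simplified] and norms = basis_norms[OF basis, simplified]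
  have q: "\<alpha> i \<bullet> \<alpha> i = 2 * s" if "i \<in> {1..<l}" for i
  proof -
    have "\<alpha> i \<bullet> \<alpha> i = \<alpha> (l - 1) \<bullet> \<alpha> (l - 1)"
    proof (rule constant_on_interval[where a = 1])
      fix i assume "1 \<le> i" "i < l - 1"
      then have "1 \<le> i" "Suc i < l" by auto
      then show "\<alpha> i \<bullet> \<alpha> i = \<alpha> (Suc i) \<bullet> \<alpha> (Suc i)"
        using norms[of i "Suc i"] by (auto simp: path_entry_def split: if_splits)
    qed (use that in auto)
    also have "\<dots> = 2 * s"
    proof -
      define k where "k = l - 1"
      then have "l = Suc k" "k \<ge> 1" using that by auto
      then show ?thesis using norms[of k l] by (auto simp: path_entry_def s_def split: if_splits)
    qed
    finally show ?thesis .
  qed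
  obtain e where e: "\<And>i j. i \<in> {1..l} \<Longrightarrow> j \<in> {1..l} \<Longrightarrow> e i \<bullet> e j = (if i = j then s else 0)"
    "e l = \<alpha> l" "\<And>i. i \<in> {1..<l} \<Longrightarrow> e i - e (Suc i) = \<alpha> i"
  proof (rule path_frame[of l \<alpha> s "\<alpha> l"])
    show "\<alpha> i \<bullet> \<alpha> j = (if i = j then 2 * s else if i = Suc j \<or> j = Suc i then - s else 0)"
      if "i \<in> {1..<l}" "j \<in> {1..<l}" for i j
      using that gram[of i j] q by (auto simp: path_entry_def)
    show "\<alpha> l \<bullet> \<alpha> j = (if Suc j = l then - s else 0)" if "j \<in> {1..<l}" for j
      using that gram[of l j] q[of j] by (auto simp: path_entry_def)
  qed (auto simp: s_def)
  have "\<Delta> = \<alpha> ` insert l {1..<l}"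
    using basis_image[OF basis] l by (simp add: atLeastLessThanSuc_atLeastAtMost[symmetric] atLeastLessThanSuc)
  then have "\<Delta> = insert (e l) ((\<lambda>i. e i - e (Suc i)) ` {1..<l})"
    using e(2,3) by (auto simp: image_iff)
  moreover have "s > 0" using basis_pos[OF basis, of l] l by (simp add: s_def)
  ultimately show ?thesis using e(1) that by blast
qed

lemma root_d_type_B:
  assumes basis: "cartan_basis (Type_B l) \<alpha>" and reduced: "reduced_roots \<Phi>" and l: "l \<ge> 2"
  shows "root_d lt \<Phi> \<psi> = sqrt (max 1 (real l / 4) * 2 / (\<psi> \<bullet> \<psi>))"
proof -
  obtain e s where s: "s > 0"
    and orth: "\<And>i j. i \<in> {1..l} \<Longrightarrow> j \<in> {1..l} \<Longrightarrow> e i \<bullet> e j = (if i = j then s else 0)"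
    and simple: "\<Delta> = insert (e l) ((\<lambda>i. e i - e (Suc i)) ` {1..<l})"
    using type_B_frame[OF basis] l by (metis one_le_numeral order_trans)
  show ?thesis
  proof (rule root_d_frame_BD[OF l s orth simple])
    have "e (l - 1) - e l \<in> \<Delta>" using simple l by (auto simp: image_iff intro!: bexI[of _ "l - 1"])
    moreover have "e l \<in> \<Delta>" using simple by simp
    ultimately have r: "e (l - 1) - e l \<in> \<Phi>" "e l \<in> \<Phi>" using simple_root by blast+
    \<comment> \<open>Reflecting e_(l-1) - e_l in the short root e_l adds 2 e_l.\<close>
    have "2 * ((e (l - 1) - e l) \<bullet> e l) / (e l \<bullet> e l) = - 2"
      using orth s l by (simp add: inner_diff)
    then show "e (l - 1) + e l \<in> \<Phi>" using reflection_root[OF r(2,1)] by (simp add: algebra_simps scaleR_2)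
    obtain \<delta> where "\<delta> \<in> \<Delta>" "\<psi> \<bullet> \<psi> = \<delta> \<bullet> \<delta>"
      using reduced_root_length[OF reduced highest_mem] by blast
    then show "\<psi> \<bullet> \<psi> \<le> 2 * s"
      using s orth l by (auto simp: simple inner_diff)
  qed auto
qed

lemma root_d_type_C:
  assumes basis: "cartan_basis (Type_C l) \<alpha>" and reduced: "reduced_roots \<Phi>" and l: "l \<ge> 2"
  shows "root_d lt \<Phi> \<psi> = sqrt (real l / (\<psi> \<bullet> \<psi>))"
proof -
  \<comment> \<open>The long simple root is 2 e_l, so a frame vector has a quarter of its squared
    length.\<close>
  define s where "s = (\<alpha> l \<bullet> \<alpha> l) / 4"
  have s: "s > 0" using basis_pos[OF basis, of l] l by (simp add: s_def)
  note gram = basis_gram[OF basis, simplified] and norms = basis_norms[OF basis, simplified]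
  have q: "\<alpha> i \<bullet> \<alpha> i = 2 * s" if "i \<in> {1..<l}" for i
  proof -
    have "\<alpha> i \<bullet> \<alpha> i = \<alpha> (l - 1) \<bullet> \<alpha> (l - 1)"
    proof (rule constant_on_interval[where a = 1])
      fix i assume "1 \<le> i" "i < l - 1"
      then have "1 \<le> i" "Suc i < l" by auto
      then show "\<alpha> i \<bullet> \<alpha> i = \<alpha> (Suc i) \<bullet> \<alpha> (Suc i)"
        using norms[of i "Suc i"] by (auto simp: path_entry_def split: if_splits)
    qed (use that in auto)
    also have "\<dots> = 2 * s"
    proof -
      define k where "k = l - 1"
      then have "l = Suc k" "k \<ge> 1" using that by auto
      then show ?thesis using norms[of k l] by (auto simp: path_entry_def s_def split: if_splits)
    qed
    finally show ?thesis .
  qed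
  obtain e where orth: "\<And>i j. i \<in> {1..l} \<Longrightarrow> j \<in> {1..l} \<Longrightarrow> e i \<bullet> e j = (if i = j then s else 0)"
    and e: "e l = (1 / 2) *\<^sub>R \<alpha> l" "\<And>i. i \<in> {1..<l} \<Longrightarrow> e i - e (Suc i) = \<alpha> i"
  proof (rule path_frame[of l \<alpha> s "(1 / 2) *\<^sub>R \<alpha> l"])
    show "\<alpha> i \<bullet> \<alpha> j = (if i = j then 2 * s else if i = Suc j \<or> j = Suc i then - s else 0)"
      if "i \<in> {1..<l}" "j \<in> {1..<l}" for i j
      using that gram[of i j] q by (auto simp: path_entry_def)
    show "((1 / 2) *\<^sub>R \<alpha> l) \<bullet> \<alpha> j = (if Suc j = l then - s else 0)" if "j \<in> {1..<l}" for j
      using that gram[of l j] q[of j] by (auto simp: path_entry_def)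
  qed (auto simp: s_def)
  have "\<Delta> = \<alpha> ` insert l {1..<l}"
    using basis_image[OF basis] l by (simp add: atLeastLessThanSuc_atLeastAtMost[symmetric] atLeastLessThanSuc)
  then have simple: "\<Delta> = insert (2 *\<^sub>R e l) ((\<lambda>i. e i - e (Suc i)) ` {1..<l})"
    using e by (auto simp: image_iff)
  show ?thesis
  proof (rule root_d_frame_C[OF _ s _ orth simple])
    show "2 *\<^sub>R e l \<in> \<Phi>" using simple simple_root by blast
    obtain \<delta> where "\<delta> \<in> \<Delta>" "\<psi> \<bullet> \<psi> = \<delta> \<bullet> \<delta>"
      using reduced_root_length[OF reduced highest_mem] by blast
    then show "\<psi> \<bullet> \<psi> \<le> 4 * s"
      using s orth l by (auto simp: simple inner_diff)
  qed (use l in auto)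
qed

lemma root_d_type_D:
  assumes basis: "cartan_basis (Type_D l) \<alpha>" and reduced: "reduced_roots \<Phi>" and l: "l \<ge> 4"
  shows "root_d lt \<Phi> \<psi> = sqrt (real l / 2 / (\<psi> \<bullet> \<psi>))"
proof -
  define s where "s = (\<alpha> l \<bullet> \<alpha> l) / 2"
  have s: "s > 0" using basis_pos[OF basis, of l] l by (simp add: s_def)
  note gram = basis_gram[OF basis, simplified] and norms = basis_norms[OF basis, simplified]
  have const: "\<alpha> i \<bullet> \<alpha> i = \<alpha> (l - 1) \<bullet> \<alpha> (l - 1)" if "i \<in> {1..<l}" for i
  proof (rule constant_on_interval[where a = 1])
    fix i assume "1 \<le> i" "i < l - 1"
    then have "1 \<le> i" "Suc i < l" by auto
    then show "\<alpha> i \<bullet> \<alpha> i = \<alpha> (Suc i) \<bullet> \<alpha> (Suc i)"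
      using norms[of i "Suc i"] by (auto simp: path_entry_def doubleton_eq_iff split: if_splits)
  qed (use that in auto)
  \<comment> \<open>Node l hangs on node l - 2 and not on l - 1, so its length is carried over
    there.\<close>
  have "\<alpha> (l - 2) \<bullet> \<alpha> (l - 2) = 2 * s"
  proof -
    define k where "k = l - 2"
    then have "l = k + 2" "k \<ge> 1" using l by auto
    then show ?thesis using norms[of k l] by (auto simp: path_entry_def doubleton_eq_iff s_def split: if_splits)
  qed
  then have q: "\<alpha> i \<bullet> \<alpha> i = 2 * s" if "i \<in> {1..<l}" for i
    using const[OF that] const[of "l - 2"] l by simp
  have l1: "\<alpha> l \<bullet> \<alpha> j = (if Suc (Suc j) = l then - s else 0)" if "j \<in> {1..<l}" for j
    using that gram[of l j] q[of j] l by (auto simp: path_entry_def doubleton_eq_iff)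
  have path: "\<alpha> i \<bullet> \<alpha> j = (if i = j then 2 * s else if i = Suc j \<or> j = Suc i then - s else 0)"
    if "i \<in> {1..<l}" "j \<in> {1..<l}" for i j
    using that gram[of i j] q by (auto simp: path_entry_def doubleton_eq_iff)
  \<comment> \<open>This solves \<alpha>_(l-1) = e_(l-1) - e_l and \<alpha>_l = e_(l-1) + e_l for
    e_l.\<close>
  define u where "u = (1 / 2) *\<^sub>R (\<alpha> l - \<alpha> (l - 1))"
  obtain e where orth: "\<And>i j. i \<in> {1..l} \<Longrightarrow> j \<in> {1..l} \<Longrightarrow> e i \<bullet> e j = (if i = j then s else 0)"
    and e: "e l = u" "\<And>i. i \<in> {1..<l} \<Longrightarrow> e i - e (Suc i) = \<alpha> i"
  proof (rule path_frame[of l \<alpha> s u])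
    show "u \<bullet> u = s"
      using l1[of "l - 1"] l1[of "l - 1", unfolded inner_commute[of "\<alpha> l"]] q[of "l - 1"] l
      by (simp add: u_def inner_diff s_def)
    show "u \<bullet> \<alpha> j = (if Suc j = l then - s else 0)" if "j \<in> {1..<l}" for j
      using that l1[of j] path[of "l - 1" j] l by (auto simp: u_def inner_diff)
  qed (use path in auto)
  have "e (l - 1) - e (Suc (l - 1)) = \<alpha> (l - 1)" using l by (intro e(2)) auto
  then have "e (l - 1) = \<alpha> (l - 1) + u" using e(1) l by (simp add: diff_eq_eq)
  moreover have "u + u = \<alpha> l - \<alpha> (l - 1)" by (simp add: u_def flip: scaleR_2)
  ultimately have sum: "e (l - 1) + e l = \<alpha> l" using e(1) by (simp add: add.assoc)
  have "\<Delta> = \<alpha> ` insert l {1..<l}"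
    using basis_image[OF basis] l by (simp add: atLeastLessThanSuc_atLeastAtMost[symmetric] atLeastLessThanSuc)
  then have simple: "\<Delta> = insert (e (l - 1) + e l) ((\<lambda>i. e i - e (Suc i)) ` {1..<l})"
    unfolding sum using e by (auto simp: image_iff)
  have "root_d lt \<Phi> \<psi> = sqrt (max 1 (real l / 4) * 2 / (\<psi> \<bullet> \<psi>))"
  proof (rule root_d_frame_BD[OF _ s orth simple])
    show "e (l - 1) + e l \<in> \<Phi>" using simple simple_root by blast
    obtain \<delta> where "\<delta> \<in> \<Delta>" "\<psi> \<bullet> \<psi> = \<delta> \<bullet> \<delta>"
      using reduced_root_length[OF reduced highest_mem] by blast
    then show "\<psi> \<bullet> \<psi> \<le> 2 * s"
      using s orth l by (auto simp: simple inner_diff inner_add)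
  qed (use l in auto)
  then show ?thesis using l by simp
qed

text \<open>Nonreducedness yields a root 2 \<gamma>, whence \<psi> \<bullet> \<psi> \<ge> 4 s, while
  simple roots have squared length at most 2 s. So \<psi> has the length of a doubled simple root,
  and only e_l can be doubled. This puts 2 e_l into \<Phi>, and the situation is that of type C with
  another last simple root.\<close>

lemma root_d_nonreduced:
  assumes basis: "cartan_basis (Type_B l) \<alpha>" and nonreduced: "\<not> reduced_roots \<Phi>" and l: "l \<ge> 1"
  shows "root_d lt \<Phi> \<psi> = sqrt (real l / (\<psi> \<bullet> \<psi>))"
proof -
  obtain e s where s: "s > 0"
    and orth: "\<And>i j. i \<in> {1..l} \<Longrightarrow> j \<in> {1..l} \<Longrightarrow> e i \<bullet> e j = (if i = j then s else 0)"
    and simple: "\<Delta> = insert (e l) ((\<lambda>i. e i - e (Suc i)) ` {1..<l})"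
    using type_B_frame[OF basis l] by metis
  have simple_norm: "s \<le> \<delta> \<bullet> \<delta>" "\<delta> \<bullet> \<delta> \<le> 2 * s" "\<delta> = e l \<or> \<delta> \<bullet> \<delta> = 2 * s" if "\<delta> \<in> \<Delta>" for \<delta>
    using that s orth l by (auto simp: simple inner_diff)
  \<comment> \<open>A long simple root \<delta> has a neighbour \<gamma> with inner product - s, and
    the Cartan integer of \<gamma> relative to 2 \<delta> would be -1/2.\<close>
  have double: "2 *\<^sub>R \<delta> \<notin> \<Phi>" if \<delta>: "\<delta> \<in> \<Delta>" "\<delta> \<noteq> e l" for \<delta>
  proof
    assume d: "2 *\<^sub>R \<delta> \<in> \<Phi>"
    obtain i where i: "i \<in> {1..<l}" "\<delta> = e i - e (Suc i)" using \<delta> by (auto simp: simple)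
    obtain \<gamma> where \<gamma>: "\<gamma> \<in> \<Delta>" "\<gamma> \<bullet> \<delta> = - s"
    proof (cases "Suc i = l")
      case True
      then show ?thesis using that[of "e l"] simple orth i by (auto simp: inner_diff)
    next
      case False
      then show ?thesis using that[of "e (Suc i) - e (Suc (Suc i))"] simple orth i
        by (auto simp: inner_diff)
    qed
    have "\<delta> \<bullet> \<delta> = 2 * s" using simple_norm(3) \<delta> by blast
    then have "2 * (\<gamma> \<bullet> (2 *\<^sub>R \<delta>)) / ((2 *\<^sub>R \<delta>) \<bullet> (2 *\<^sub>R \<delta>)) = - 1 / 2"
      using \<gamma> s by (simp add: field_simps)
    then have "- 1 / 2 \<in> (\<int> :: real set)"
      using cartan_integer[OF d simple_root[OF \<gamma>(1)]] by simp
    then obtain z :: int where "- 1 / 2 = real_of_int z" by (rule Ints_cases)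
    then have "real_of_int (2 * z) = real_of_int (- 1)" by simp
    then have "2 * z = - 1" by (simp only: of_int_eq_iff)
    then show False by presburger
  qed
  obtain \<gamma> where \<gamma>: "\<gamma> \<in> \<Phi>" "2 *\<^sub>R \<gamma> \<in> \<Phi>"
  proof -
    obtain \<beta> c where \<beta>: "\<beta> \<in> \<Phi>" "c *\<^sub>R \<beta> \<in> \<Phi>" "c \<noteq> 1" "c \<noteq> (- 1 :: real)"
      using nonreduced unfolding reduced_roots_def by blast
    have c0: "c \<noteq> 0" using \<beta> zero_not_root by auto
    have \<beta>0: "\<beta> \<bullet> \<beta> > 0" using \<beta> root_inner_pos by blast
    \<comment> \<open>The integers 2 c and 2 / c have product 4, so c, being neither 1 nor -1, is 2
      or 1/2 up to sign. The shorter of the two roots is the wanted \<gamma>, up to sign.\<close>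
    have "2 * c \<in> \<int>" using cartan_integer[OF \<beta>(1,2)] \<beta>0 by simp
    moreover have "2 / c \<in> \<int>" using cartan_integer[OF \<beta>(2,1)] \<beta>0 c0 by (simp add: field_simps)
    ultimately obtain m n :: int where mn: "2 * c = m" "2 / c = n" by (metis Ints_cases)
    have "real_of_int (m * n) = real_of_int 4" using mn c0 by (simp add: field_simps flip: mn)
    then have "m * n = 4" by (simp only: of_int_eq_iff)
    then have "m dvd 4" by (metis dvd_triv_left)
    then have "\<bar>m\<bar> \<le> 4" using dvd_imp_le_int[of 4 m] by simp
    moreover have "m \<noteq> 3" "m \<noteq> - 3" "m \<noteq> 0" using \<open>m dvd 4\<close> by auto
    moreover have "m \<noteq> 2" "m \<noteq> - 2" using mn(1) \<beta>(3,4) by auto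
    ultimately have "m = 4 \<or> m = - 4 \<or> m = 1 \<or> m = - 1" by arith
    then have "c = 2 \<or> c = - 2 \<or> c = 1 / 2 \<or> c = - 1 / 2" using mn(1) by auto
    then show ?thesis
    proof (elim disjE)
      assume "c = - 2"
      then show ?thesis using that[of \<beta>] \<beta> uminus_root[OF \<beta>(2)] by simp
    next
      assume "c = - 1 / 2"
      then show ?thesis using that[of "- (c *\<^sub>R \<beta>)"] \<beta> uminus_root[OF \<beta>(2)] by simp
    next
      assume c: "c = 1 / 2"
      have "2 *\<^sub>R (c *\<^sub>R \<beta>) = \<beta>" unfolding c by simp
      then show ?thesis using that[of "c *\<^sub>R \<beta>"] \<beta> by simp
    qed (use that[of \<beta>] \<beta> in auto)
  qed
  obtain \<delta>' c' where "\<delta>' \<in> \<Delta>" "c' = 1 \<or> c' = (2::real)" "\<gamma> \<bullet> \<gamma> = c'\<^sup>2 * (\<delta>' \<bullet> \<delta>')"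
    using root_length[OF \<gamma>(1)] by blast
  then have "s \<le> \<gamma> \<bullet> \<gamma>" using simple_norm(1)[of \<delta>'] s by auto
  then have large: "4 * s \<le> \<psi> \<bullet> \<psi>" using highest_long[OF \<gamma>(2)] by simp
  obtain \<delta> c where \<delta>: "\<delta> \<in> \<Delta>" "c = 1 \<or> c = (2::real)" "c *\<^sub>R \<delta> \<in> \<Phi>" "\<psi> \<bullet> \<psi> = c\<^sup>2 * (\<delta> \<bullet> \<delta>)"
    using root_length[OF highest_mem] by blast
  have "c = 2" using \<delta> large simple_norm(2)[OF \<delta>(1)] s by auto
  moreover from this have "\<delta> = e l" using double[OF \<delta>(1)] \<delta>(3) by blast
  ultimately have last: "2 *\<^sub>R e l \<in> \<Phi>" "\<psi> \<bullet> \<psi> \<le> 4 * s" using \<delta> orth l by auto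
  show ?thesis
    by (rule root_d_frame_C[where c = 1, OF l s _ orth]) (use last simple in auto)
qed

end

section \<open>Passage to the indivisible roots\<close>

context ordered_root_system
begin

text \<open>Otherwise 1/2 would be a Cartan integer. Hence the half of a divisible root is itself
  indivisible.\<close>

lemma quarter_not_root:
  assumes "\<alpha> \<in> \<Phi>"
  shows "(1 / 4) *\<^sub>R \<alpha> \<notin> \<Phi>"
proof
  assume h: "(1 / 4) *\<^sub>R \<alpha> \<in> \<Phi>"
  have "2 * ((1 / 4) *\<^sub>R \<alpha> \<bullet> \<alpha>) / (\<alpha> \<bullet> \<alpha>) = 1 / 2"
    using assms zero_not_root by auto
  then have "1 / 2 \<in> (\<int> :: real set)" using cartan_integer[OF assms h] by (simp only:)
  then obtain z :: int where "1 / 2 = real_of_int z" by (rule Ints_cases)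
  then have "real_of_int (2 * z) = real_of_int 1" by simp
  then have "2 * z = 1" by (simp only: of_int_eq_iff)
  then show False by presburger
qed

text \<open>A reflection is linear and its own inverse: if half of a reflected root were a root,
  reflecting back would give half of the original. The span survives because every root is an
  indivisible one or twice one.\<close>

lemma ordered_root_system_indivisible: "ordered_root_system (indivisible_roots \<Phi>) lt"
proof
  let ?I = "indivisible_roots \<Phi>"
  have sub: "?I \<subseteq> \<Phi>" by (auto simp: indivisible_roots_def)
  have "\<beta> - (2 * (\<beta> \<bullet> \<alpha>) / (\<alpha> \<bullet> \<alpha>)) *\<^sub>R \<alpha> \<in> ?I" if \<alpha>: "\<alpha> \<in> ?I" and \<beta>: "\<beta> \<in> ?I" for \<alpha> \<beta>
  proof -
    define k where "k = 2 * (\<beta> \<bullet> \<alpha>) / (\<alpha> \<bullet> \<alpha>)"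
    define \<gamma> where "\<gamma> = \<beta> - k *\<^sub>R \<alpha>"
    have r: "\<alpha> \<in> \<Phi>" "\<beta> \<in> \<Phi>" using \<alpha> \<beta> sub by auto
    have "\<alpha> \<bullet> \<alpha> > 0" using root_inner_pos[OF r(1)] .
    then have \<gamma>\<alpha>: "2 * (((1 / 2) *\<^sub>R \<gamma>) \<bullet> \<alpha>) / (\<alpha> \<bullet> \<alpha>) = - k / 2"
      by (simp add: \<gamma>_def k_def inner_diff field_simps)
    have "(1 / 2) *\<^sub>R \<gamma> \<notin> \<Phi>"
    proof
      assume "(1 / 2) *\<^sub>R \<gamma> \<in> \<Phi>"
      from reflection_root[OF r(1) this] have "(1 / 2) *\<^sub>R \<gamma> + (k / 2) *\<^sub>R \<alpha> \<in> \<Phi>"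
        unfolding \<gamma>\<alpha> by simp
      then have "(1 / 2) *\<^sub>R \<beta> \<in> \<Phi>" by (simp add: \<gamma>_def algebra_simps)
      then show False using \<beta> by (simp add: indivisible_roots_def)
    qed
    then show ?thesis using reflection_root[OF r] by (simp add: indivisible_roots_def \<gamma>_def k_def)
  qed
  moreover have "span ?I = UNIV"
  proof -
    have "\<alpha> \<in> span ?I" if \<alpha>: "\<alpha> \<in> \<Phi>" for \<alpha>
    proof (cases "(1 / 2) *\<^sub>R \<alpha> \<in> \<Phi>")
      case True
      then have "(1 / 2) *\<^sub>R \<alpha> \<in> ?I"
        using quarter_not_root[OF \<alpha>] by (simp add: indivisible_roots_def)
      then have "2 *\<^sub>R ((1 / 2) *\<^sub>R \<alpha>) \<in> span ?I" by (intro span_scale span_base)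
      then show ?thesis by simp
    next
      case False
      then show ?thesis using \<alpha> by (intro span_base) (simp add: indivisible_roots_def)
    qed
    then have "span \<Phi> \<subseteq> span ?I" by (intro span_minimal) auto
    then show ?thesis using span_roots by auto
  qed
  ultimately show "root_system ?I"
    using finite_subset[OF sub finite_roots] subsetD[OF sub] zero_not_root cartan_integer
    unfolding root_system_def by metis
qed (rule ordering)

text \<open>A simple root is indivisible, since \<delta> = \<delta>/2 + \<delta>/2 would decompose
  it, and it stays indecomposable among fewer roots. Equality follows by counting, as both sets are
  bases of V.\<close>

lemma simple_roots_indivisible: "simple_roots lt (indivisible_roots \<Phi>) = \<Delta>"
proof -
  interpret I: ordered_root_system "indivisible_roots \<Phi>" lt
    by (rule ordered_root_system_indivisible)
  have "\<Delta> \<subseteq> I.\<Delta>"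
  proof
    fix \<delta> assume \<delta>: "\<delta> \<in> \<Delta>"
    have pos: "positive_roots lt (indivisible_roots \<Phi>) \<subseteq> positive_roots lt \<Phi>"
      by (auto simp: positive_roots_def indivisible_roots_def)
    have "(1 / 2) *\<^sub>R \<delta> \<notin> \<Phi>"
    proof
      assume "(1 / 2) *\<^sub>R \<delta> \<in> \<Phi>"
      then have "(1 / 2) *\<^sub>R \<delta> \<in> positive_roots lt \<Phi>"
        using pos_scale[OF simple_pos[OF \<delta>], of "1 / 2"] by (simp add: positive_roots_def)
      moreover have "\<delta> = (1 / 2) *\<^sub>R \<delta> + (1 / 2) *\<^sub>R \<delta>" by (simp flip: scaleR_add_left)
      ultimately show False using \<delta> unfolding simple_roots_def by blast
    qed
    then have "\<delta> \<in> positive_roots lt (indivisible_roots \<Phi>)"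
      using simple_pos[OF \<delta>] simple_root[OF \<delta>] by (simp add: positive_roots_def indivisible_roots_def)
    then show "\<delta> \<in> I.\<Delta>" using \<delta> pos unfolding simple_roots_def by blast
  qed
  then show ?thesis
    using card_subset_eq[OF I.finite_simple] card_simple I.card_simple by metis
qed

end

section \<open>Type A and tabulated inverse Cartan matrices\<close>

text \<open>The Gram matrix of a path acts as s times the negative second difference; the zero
  values at 0 and l + 1 make the formula valid at both ends.\<close>

lemma path_gram_combination:
  fixes \<alpha> :: "nat \<Rightarrow> 'a::euclidean_space"
  assumes gram: "\<And>i. i \<in> {1..l} \<Longrightarrow>
      \<alpha> i \<bullet> \<alpha> j = (if i = j then 2 * s else if i = Suc j \<or> j = Suc i then - s else 0)"
    and f: "f 0 = 0" "f (Suc l) = 0" and j: "j \<in> {1..l}"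
  shows "(\<Sum>i=1..l. f i *\<^sub>R \<alpha> i) \<bullet> \<alpha> j = s * (2 * f j - f (j - 1) - f (Suc j))"
proof -
  have "(\<Sum>i=1..l. f i *\<^sub>R \<alpha> i) \<bullet> \<alpha> j = (\<Sum>i=1..l. (if i = j then 2 * s * f i else 0)
      + (if i = Suc j then - s * f i else 0) + (if i = j - 1 then - s * f i else 0))"
    unfolding inner_sum_left by (intro sum.cong) (use gram j in auto)
  also have "\<dots> = s * (2 * f j - f (j - 1) - f (Suc j))"
  proof -
    have "(\<Sum>i=1..l. if i = j then 2 * s * f i else 0) = 2 * s * f j" using j by simp
    moreover have "(\<Sum>i=1..l. if i = Suc j then - s * f i else 0) = - s * f (Suc j)"
      using f j by (cases "j = l") auto
    moreover have "(\<Sum>i=1..l. if i = j - 1 then - s * f i else 0) = - s * f (j - 1)"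
      using f j by (cases "j = 1") auto
    ultimately show ?thesis unfolding sum.distrib by (simp only:) (simp add: algebra_simps)
  qed
  finally show ?thesis .
qed

context root_system_with_highest
begin

text \<open>All coefficients of \<psi> are 1, so the longest dual vector decides. The squared norm
  of \<omega>_k is proportional to k (l + 1 - k), largest in the middle: there is one middle index
  for odd l and a tie of two for even l, which causes the case split.\<close>

lemma root_d_type_A:
  assumes basis: "cartan_basis (Type_A l) \<alpha>" and reduced: "reduced_roots \<Phi>" and l: "l \<ge> 1"
  shows "odd l \<Longrightarrow> root_d lt \<Phi> \<psi> = sqrt ((real l + 1) / 2 / (\<psi> \<bullet> \<psi>))"
    and "even l \<Longrightarrow> root_d lt \<Phi> \<psi> = sqrt (real l * (real l + 2) / (2 * (real l + 1)) / (\<psi> \<bullet> \<psi>))"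
proof -
  define s where "s = (\<alpha> l \<bullet> \<alpha> l) / 2"
  have s: "s > 0" using basis_pos[OF basis, of l] l by (simp add: s_def)
  note gram' = basis_gram[OF basis, simplified] and norms = basis_norms[OF basis, simplified]
  have bij: "bij_betw \<alpha> {1..l} \<Delta>" using basis by (simp add: cartan_basis_def)
  have image: "\<Delta> = \<alpha> ` {1..l}" using basis_image[OF basis] by simp
  have q: "\<alpha> i \<bullet> \<alpha> i = 2 * s" if "i \<in> {1..l}" for i
  proof -
    have "\<alpha> i \<bullet> \<alpha> i = \<alpha> l \<bullet> \<alpha> l"
    proof (rule constant_on_interval[where a = 1])
      fix i assume "1 \<le> i" "i < l"
      then show "\<alpha> i \<bullet> \<alpha> i = \<alpha> (Suc i) \<bullet> \<alpha> (Suc i)"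
        using norms[of i "Suc i"] by (auto simp: path_entry_def split: if_splits)
    qed (use that in auto)
    then show ?thesis by (simp add: s_def)
  qed
  have gram: "\<alpha> i \<bullet> \<alpha> j = (if i = j then 2 * s else if i = Suc j \<or> j = Suc i then - s else 0)"
    if "i \<in> {1..l}" "j \<in> {1..l}" for i j
    using that gram'[of i j] q by (auto simp: path_entry_def)
  have norm: "\<beta> \<bullet> \<beta> = 2 * s" if "\<beta> \<in> \<Phi>" for \<beta>
    using reduced_root_length[OF reduced that] q unfolding image by (metis imageE)
  \<comment> \<open>Of the summands from n + 1 to l only the first is a neighbour of \<alpha>_n, so
    a reflection adds \<alpha>_n.\<close>
  have root: "(\<Sum>i=k..l. \<alpha> i) \<in> \<Phi>" if "1 \<le> k" "k \<le> l" for k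
    using that(2,1)
  proof (induction rule: inc_induct)
    case base
    then show ?case using simple_root[of "\<alpha> l"] image l by simp
  next
    case (step n)
    have "\<alpha> n \<bullet> (\<Sum>i=Suc n..l. \<alpha> i) = (\<Sum>i=Suc n..l. if i = Suc n then - s else 0)"
      unfolding inner_sum_right by (intro sum.cong) (use gram step in auto)
    also have "\<dots> = - (\<alpha> n \<bullet> \<alpha> n) / 2" using step q[of n] by simp
    finally have "(\<Sum>i=Suc n..l. \<alpha> i) + \<alpha> n \<in> \<Phi>"
      using step simple_root image by (intro add_root_if_inner) auto
    then show ?case using step by (simp add: sum.atLeast_Suc_atMost add.commute)
  qed
  define \<theta> where "\<theta> = (\<Sum>i=1..l. \<alpha> i)"
  have \<theta>: "\<theta> \<in> \<Phi>" using root[of 1] l by (simp add: \<theta>_def)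
  have "\<theta> \<bullet> \<delta> \<ge> 0" if \<delta>: "\<delta> \<in> \<Delta>" for \<delta>
  proof -
    obtain j where j: "j \<in> {1..l}" "\<delta> = \<alpha> j" using \<delta> image by auto
    \<comment> \<open>The second difference of the indicator of {1..l} is concentrated at the two
      ends, with the sign that makes \<theta> dominant.\<close>
    define f where "f i = (if i \<in> {1..l} then 1 else 0 :: real)" for i
    have "\<theta> = (\<Sum>i=1..l. f i *\<^sub>R \<alpha> i)" by (simp add: \<theta>_def f_def)
    then have "\<theta> \<bullet> \<delta> = s * (2 * f j - f (j - 1) - f (Suc j))"
      using j path_gram_combination[of l \<alpha> j s f] gram by (auto simp: f_def)
    moreover have "2 * f j - f (j - 1) - f (Suc j) \<ge> 0" using j by (simp add: f_def)
    ultimately show ?thesis using s by simp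
  qed
  then have \<psi>: "\<psi> = \<theta>" using highest_eq_long_dominant[OF \<theta>] norm[OF \<theta>] norm[OF highest_mem] by simp
  have \<psi>\<psi>: "\<psi> \<bullet> \<psi> = 2 * s" using norm[OF highest_mem] .
  define L where "L = real l + 1"
  have L: "L > 0" by (simp add: L_def)
  \<comment> \<open>The Green function of the negative second difference with zero boundary values:
    min(i, k) - i k / (l + 1) is the inverse Cartan matrix.\<close>
  define f where "f k i = (real (min i k) - real i * real k / L) / s" for k i :: nat
  define \<omega> where "\<omega> k = (\<Sum>i=1..l. f k i *\<^sub>R \<alpha> i)" for k
  have dual: "\<omega> i \<bullet> \<alpha> j = (if i = j then 1 else 0)" if "i \<in> {1..l}" "j \<in> {1..l}" for i j
  proof -
    have "\<omega> i \<bullet> \<alpha> j = s * (2 * f i j - f i (j - 1) - f i (Suc j))"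
      unfolding \<omega>_def using that gram by (intro path_gram_combination) (auto simp: f_def L_def add.commute)
    also have "\<dots> = 2 * real (min j i) - real (min (j - 1) i) - real (min (Suc j) i)
        - (2 * real j - real (j - 1) - real (Suc j)) * real i / L"
      using s L by (simp add: f_def field_simps)
    also have "2 * real j - real (j - 1) - real (Suc j) = 0" using that by (simp add: of_nat_diff)
    also have "2 * real (min j i) - real (min (j - 1) i) - real (min (Suc j) i) - 0 * real i / L
        = (if i = j then 1 else 0)"
      using that by (auto simp: min_def of_nat_diff)
    finally show ?thesis .
  qed
  have \<omega>: "\<omega> k \<bullet> \<omega> k = real k * (L - real k) / (L * s)" if "k \<in> {1..l}" for k
  proof -
    have "\<omega> k \<bullet> \<omega> k = (\<Sum>i=1..l. f k i * (\<omega> k \<bullet> \<alpha> i))"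
      by (subst (2) \<omega>_def) (simp add: inner_sum_right)
    also have "\<dots> = (\<Sum>i=1..l. if i = k then f k i else 0)"
      by (intro sum.cong) (use dual that in auto)
    also have "\<dots> = f k k" using that by simp
    also have "\<dots> = real k * (L - real k) / (L * s)" using L s by (simp add: f_def field_simps)
    finally show ?thesis .
  qed
  have vertices: "root_d lt \<Phi> \<psi> = sqrt (real k * (L - real k) / (L * s))"
    if k: "k \<in> {1..l}" and max: "\<And>i. i \<in> {1..l} \<Longrightarrow> real i * (L - real i) \<le> real k * (L - real k)" for k
  proof (rule root_d_vertices[OF bij dual])
    show "\<psi> = (\<Sum>i=1..l. 1 *\<^sub>R \<alpha> i)" by (simp add: \<psi> \<theta>_def)
    show "\<omega> i \<bullet> \<omega> i \<le> real k * (L - real k) / (L * s) * 1\<^sup>2" if "i \<in> {1..l}" for i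
      using max[OF that] L s by (simp add: \<omega>[OF that] divide_right_mono)
  qed (use k \<omega> in auto)
  show "root_d lt \<Phi> \<psi> = sqrt ((real l + 1) / 2 / (\<psi> \<bullet> \<psi>))" if odd: "odd l"
  proof -
    obtain m where m: "l = 2 * m + 1" using odd by (rule oddE)
    have Lm: "L = 2 * real (m + 1)" by (simp add: L_def m)
    have "root_d lt \<Phi> \<psi> = sqrt (real (m + 1) * (L - real (m + 1)) / (L * s))"
    proof (rule vertices)
      fix i
      have "0 \<le> (real i - real (m + 1))\<^sup>2" by simp
      then show "real i * (L - real i) \<le> real (m + 1) * (L - real (m + 1))"
        by (simp add: Lm power2_eq_square algebra_simps)
    qed (use m in auto)
    also have "real (m + 1) * (L - real (m + 1)) / (L * s) = (real l + 1) / 2 / (\<psi> \<bullet> \<psi>)"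
    proof -
      define x where "x = real (m + 1)"
      have "x > 0" "L = 2 * x" "real l + 1 = 2 * x" by (simp_all add: x_def Lm m)
      then show ?thesis unfolding \<psi>\<psi> x_def[symmetric] using s by (simp add: field_simps)
    qed
    finally show ?thesis .
  qed
  show "root_d lt \<Phi> \<psi> = sqrt (real l * (real l + 2) / (2 * (real l + 1)) / (\<psi> \<bullet> \<psi>))" if even: "even l"
  proof -
    obtain m where m: "l = 2 * m" using even by (rule evenE)
    have Lm: "L = 2 * real m + 1" by (simp add: L_def m)
    have "root_d lt \<Phi> \<psi> = sqrt (real m * (L - real m) / (L * s))"
    proof (rule vertices)
      fix i
      \<comment> \<open>This product of consecutive integers is the difference of the values of i (L
        - i) at m and at i; it is nonnegative although it dips below zero over the reals.\<close>
      have "(int i - int m) * (int i - int m - 1) \<ge> 0"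
        by (cases "int i \<le> int m") (auto intro: mult_nonneg_nonneg mult_nonpos_nonpos)
      then have "real_of_int ((int i - int m) * (int i - int m - 1)) \<ge> 0" by linarith
      then show "real i * (L - real i) \<le> real m * (L - real m)"
        by (simp add: Lm algebra_simps)
    qed (use l m in auto)
    also have "real m * (L - real m) / (L * s) = real l * (real l + 2) / (2 * (real l + 1)) / (\<psi> \<bullet> \<psi>)"
    proof -
      have eqs: "L - real m = real m + 1" "real l = 2 * real m" "2 * real m + 1 = L" by (simp_all add: Lm m)
      show ?thesis unfolding \<psi>\<psi> eqs using s L by (simp add: field_simps)
    qed
    finally show ?thesis .
  qed
qed

text \<open>\<open>C i j * c j\<close> are the inner products of the simple roots in units of \<open>t\<close>, and \<open>W\<close> is \<open>d\<close> times
  the inverse of that matrix; \<open>p\<close> is the index of a longest simple root and \<open>q\<close> that of the vertex with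
  the largest norm. The integers \<open>n i\<close> and \<open>k i\<close> stand for the coefficients of the highest
  root and for \<open>2 (\<psi>, \<alpha>\<^sub>i) / (\<psi>, \<psi>)\<close>; the assumption on them forces \<open>(\<psi>, \<theta>) \<ge> (\<psi>, \<psi>)\<close>
  for \<open>\<theta> = \<Sum> m\<^sub>i \<alpha>\<^sub>i\<close>, hence \<open>\<psi> = \<theta>\<close>.\<close>

lemma root_d_inverse_cartan:
  fixes c m :: "nat \<Rightarrow> int" and W :: "nat \<Rightarrow> nat \<Rightarrow> int" and d :: int and t :: real
  assumes basis: "cartan_basis X \<alpha>" and reduced: "reduced_roots \<Phi>"
    and I: "I = {1..cartan_rank X}" and C: "C = cartan_matrix X"
    and t: "t > 0" and norms: "\<And>i. i \<in> I \<Longrightarrow> \<alpha> i \<bullet> \<alpha> i = 2 * t * c i"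
    and inverse: "\<forall>i\<in>I. \<forall>j\<in>I. (\<Sum>k\<in>I. W i k * (C k j * c j)) = (if i = j then d else 0)"
    and d: "d > 0" and p: "p \<in> I" "\<forall>i\<in>I. c i \<le> c p"
    and m: "\<forall>i\<in>I. m i > 0" and \<theta>: "(\<Sum>i\<in>I. \<Sum>j\<in>I. m i * m j * (C i j * c j)) = 2 * c p"
    and highest: "\<And>n k :: nat \<Rightarrow> int. \<lbrakk>\<forall>i\<in>I. n i \<ge> 1; \<forall>i\<in>I. k i \<ge> 0;
        \<forall>i\<in>I. d * n i = c p * (\<Sum>j\<in>I. W i j * k j)\<rbrakk> \<Longrightarrow> (\<Sum>i\<in>I. m i * k i) \<ge> 2"
    and q: "q \<in> I" "\<forall>i\<in>I. W i i * (m q)\<^sup>2 \<le> W q q * (m i)\<^sup>2"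
  shows "root_d lt \<Phi> \<psi> = sqrt (2 * c p * W q q / (d * (m q)\<^sup>2) / (\<psi> \<bullet> \<psi>))"
proof -
  have bij: "bij_betw \<alpha> I \<Delta>" using basis by (simp add: cartan_basis_def I)
  have image: "\<Delta> = \<alpha> ` I" and fin: "finite I" using bij by (auto simp: bij_betw_def I)
  have gram: "\<alpha> i \<bullet> \<alpha> j = t * real_of_int (C i j * c j)" if "i \<in> I" "j \<in> I" for i j
    using basis_gram[OF basis, of i j] norms[of j] that by (simp add: I C)
  have pos: "t * c i > 0" if "i \<in> I" for i
    using basis_pos[OF basis, of i] norms[of i] that by (simp add: I)
  \<comment> \<open>\<psi> has the length of some simple root and no root is longer, so it has the
    length of \<open>\<alpha> p\<close>.\<close>
  obtain \<delta> where "\<delta> \<in> \<Delta>" "\<psi> \<bullet> \<psi> = \<delta> \<bullet> \<delta>"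
    using reduced_root_length[OF reduced highest_mem] by blast
  then obtain i0 where i0: "i0 \<in> I" "\<psi> \<bullet> \<psi> = \<alpha> i0 \<bullet> \<alpha> i0" using image by auto
  have "\<alpha> p \<in> \<Phi>" using p image simple_root by blast
  then have "\<alpha> p \<bullet> \<alpha> p \<le> \<alpha> i0 \<bullet> \<alpha> i0" using highest_long i0 by metis
  then have "c p \<le> c i0" using norms p(1) i0(1) t by simp
  then have "c i0 = c p" using p(2) i0(1) by force
  then have \<psi>\<psi>: "\<psi> \<bullet> \<psi> = 2 * t * c p" using i0 norms by simp
  have cp: "real_of_int (c p) > 0" using pos[OF p(1)] t by (simp add: zero_less_mult_iff)
  obtain n :: "'a \<Rightarrow> nat" where n: "\<psi> = (\<Sum>\<delta>\<in>\<Delta>. real (n \<delta>) *\<^sub>R \<delta>)" "\<And>\<delta>. \<delta> \<in> \<Delta> \<Longrightarrow> n \<delta> > 0"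
    using highest_combination by blast
  define \<nu> where "\<nu> i = int (n (\<alpha> i))" for i
  have \<psi>\<nu>: "\<psi> = (\<Sum>i\<in>I. real_of_int (\<nu> i) *\<^sub>R \<alpha> i)"
    using sum.reindex_bij_betw[OF bij, of "\<lambda>\<delta>. real (n \<delta>) *\<^sub>R \<delta>"] by (simp add: n(1)[symmetric] \<nu>_def)
  have "\<forall>i\<in>I. \<exists>k::int. 2 * (\<alpha> i \<bullet> \<psi>) / (\<psi> \<bullet> \<psi>) = k"
    using cartan_integer[OF highest_mem] simple_root image by (metis Ints_cases imageI)
  then obtain k :: "nat \<Rightarrow> int" where "\<forall>i\<in>I. 2 * (\<alpha> i \<bullet> \<psi>) / (\<psi> \<bullet> \<psi>) = k i"
    using bchoice[of I "\<lambda>i k. 2 * (\<alpha> i \<bullet> \<psi>) / (\<psi> \<bullet> \<psi>) = real_of_int k"] by blast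
  then have k: "\<psi> \<bullet> \<alpha> i = t * c p * k i" if "i \<in> I" for i
    using that t cp by (simp add: \<psi>\<psi> inner_commute field_simps)
  \<comment> \<open>The rows of \<open>W\<close>, divided by t d, are the coefficients of the basis
    dual to the simple roots.\<close>
  define \<omega> where "\<omega> i = (1 / (t * d)) *\<^sub>R (\<Sum>j\<in>I. real_of_int (W i j) *\<^sub>R \<alpha> j)" for i
  have dual: "\<omega> i \<bullet> \<alpha> j = (if i = j then 1 else 0)" if "i \<in> I" "j \<in> I" for i j
  proof -
    have "\<omega> i \<bullet> \<alpha> j = 1 / (t * d) * (t * real_of_int (\<Sum>k\<in>I. W i k * (C k j * c j)))"
      using that by (simp add: \<omega>_def inner_sum_left gram sum_distrib_left mult_ac)
    also have "(\<Sum>k\<in>I. W i k * (C k j * c j)) = (if i = j then d else 0)" using inverse that by blast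
    finally show ?thesis using t d by simp
  qed
  have "(\<Sum>i\<in>I. m i * k i) \<ge> 2"
  proof (rule highest)
    show "\<forall>i\<in>I. \<nu> i \<ge> 1" using n(2) image by (force simp: \<nu>_def)
    show "\<forall>i\<in>I. k i \<ge> 0"
    proof
      fix i assume i: "i \<in> I"
      then have "t * c p * k i \<ge> 0" using highest_dominant[of "\<alpha> i"] image k by auto
      then show "k i \<ge> 0" using pos[OF p(1)] by (metis not_le of_int_0_le_iff zero_le_mult_iff)
    qed
    \<comment> \<open>\<open>\<omega> i \<bullet> \<psi>\<close> is computed twice: expanding \<psi>
      gives the coefficient \<nu> i, expanding \<omega> i gives a combination of the k j.\<close>
    show "\<forall>i\<in>I. d * \<nu> i = c p * (\<Sum>j\<in>I. W i j * k j)"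
    proof
      fix i assume i: "i \<in> I"
      have "\<omega> i \<bullet> \<psi> = (\<Sum>j\<in>I. if j = i then real_of_int (\<nu> j) else 0)"
        unfolding \<psi>\<nu> inner_sum_right by (intro sum.cong) (use dual i in auto)
      then have "\<nu> i = \<omega> i \<bullet> \<psi>" using i fin by simp
      also have "\<dots> = 1 / (t * d) * (\<Sum>j\<in>I. W i j * (\<psi> \<bullet> \<alpha> j))"
        by (simp add: \<omega>_def inner_sum_left inner_commute[of \<psi>])
      also have "(\<Sum>j\<in>I. W i j * (\<psi> \<bullet> \<alpha> j)) = t * (c p * (\<Sum>j\<in>I. W i j * k j))"
        by (simp add: k sum_distrib_left mult_ac)
      finally have "real_of_int (d * \<nu> i) = real_of_int (c p * (\<Sum>j\<in>I. W i j * k j))"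
        using t d by (simp add: field_simps)
      then show "d * \<nu> i = c p * (\<Sum>j\<in>I. W i j * k j)" by (simp only: of_int_eq_iff)
    qed
  qed
  then have mk: "real_of_int (\<Sum>i\<in>I. m i * k i) \<ge> 2" by linarith
  define \<theta> where "\<theta> = (\<Sum>i\<in>I. real_of_int (m i) *\<^sub>R \<alpha> i)"
  have "\<theta> \<bullet> \<theta> = (\<Sum>i\<in>I. \<Sum>j\<in>I. m i * m j * (t * real_of_int (C i j * c j)))"
    unfolding \<theta>_def inner_sum_left inner_sum_right
    by (subst sum.swap, intro sum.cong) (simp_all add: gram mult_ac)
  also have "\<dots> = t * real_of_int (\<Sum>i\<in>I. \<Sum>j\<in>I. m i * m j * (C i j * c j))"
    by (simp add: sum_distrib_left mult_ac)
  finally have \<theta>\<theta>: "\<theta> \<bullet> \<theta> = 2 * t * c p" unfolding \<theta> by simp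
  have "\<psi> \<bullet> \<theta> = (t * c p) * real_of_int (\<Sum>i\<in>I. m i * k i)"
    unfolding \<theta>_def inner_sum_right by (simp add: k sum_distrib_left mult_ac)
  also have "\<dots> \<ge> (t * c p) * 2" using mk t cp by (intro mult_left_mono) auto
  finally have \<psi>: "\<psi> = \<theta>" by (intro eq_of_inner_eq) (auto simp: \<theta>\<theta> \<psi>\<psi>)
  have \<omega>: "\<omega> i \<bullet> \<omega> i = W i i / (t * d)" if "i \<in> I" for i
  proof -
    have "\<omega> i \<bullet> \<omega> i = (1 / (t * d)) * (\<Sum>j\<in>I. W i j * (\<omega> i \<bullet> \<alpha> j))"
      by (subst (2) \<omega>_def) (simp add: inner_sum_right)
    also have "(\<Sum>j\<in>I. W i j * (\<omega> i \<bullet> \<alpha> j)) = (\<Sum>j\<in>I. if j = i then real_of_int (W i j) else 0)"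
      by (intro sum.cong) (use dual that in auto)
    finally show ?thesis using that fin by simp
  qed
  have mq: "real_of_int (m q) > 0" using m q by simp
  have "root_d lt \<Phi> \<psi> = sqrt (W q q / (t * d * (m q)\<^sup>2))"
  proof (rule root_d_vertices[OF bij dual])
    show "\<psi> = (\<Sum>i\<in>I. real_of_int (m i) *\<^sub>R \<alpha> i)" by (simp add: \<psi> \<theta>_def)
    show "\<omega> i \<bullet> \<omega> i \<le> W q q / (t * d * (m q)\<^sup>2) * (real_of_int (m i))\<^sup>2" if "i \<in> I" for i
    proof -
      have "W i i * (m q)\<^sup>2 \<le> W q q * (m i)\<^sup>2" using q that by blast
      then have "real_of_int (W i i) * (m q)\<^sup>2 \<le> W q q * (m i)\<^sup>2" by (simp flip: of_int_mult of_int_power)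
      then show ?thesis using t d mq by (simp add: \<omega>[OF that] field_simps)
    qed
    show "\<omega> q \<bullet> \<omega> q = W q q / (t * d * (m q)\<^sup>2) * (real_of_int (m q))\<^sup>2"
      using mq by (simp add: \<omega>[OF q(1)])
  qed (use m q in auto)
  then show ?thesis using cp by (simp add: \<psi>\<psi> mult_ac)
qed

end

section \<open>The exceptional types and the theorem\<close>

text \<open>Three times the inverse Cartan matrix; nodes are counted from 1 and list positions from
  0. For E7 the factor is 2, for E8 it is 1.\<close>

definition inverse_E6 :: "nat \<Rightarrow> nat \<Rightarrow> int" where
  "inverse_E6 i j =
    [[4, 3, 5, 6, 4, 2],
     [3, 6, 6, 9, 6, 3],
     [5, 6, 10, 12, 8, 4],
     [6, 9, 12, 18, 12, 6],
     [4, 6, 8, 12, 10, 5],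
     [2, 3, 4, 6, 5, 4]] ! (i - 1) ! (j - 1)"

definition inverse_E7 :: "nat \<Rightarrow> nat \<Rightarrow> int" where
  "inverse_E7 i j =
    [[4, 4, 6, 8, 6, 4, 2],
     [4, 7, 8, 12, 9, 6, 3],
     [6, 8, 12, 16, 12, 8, 4],
     [8, 12, 16, 24, 18, 12, 6],
     [6, 9, 12, 18, 15, 10, 5],
     [4, 6, 8, 12, 10, 8, 4],
     [2, 3, 4, 6, 5, 4, 3]] ! (i - 1) ! (j - 1)"

definition inverse_E8 :: "nat \<Rightarrow> nat \<Rightarrow> int" where
  "inverse_E8 i j =
    [[4, 5, 7, 10, 8, 6, 4, 2],
     [5, 8, 10, 15, 12, 9, 6, 3],
     [7, 10, 14, 20, 16, 12, 8, 4],
     [10, 15, 20, 30, 24, 18, 12, 6],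
     [8, 12, 16, 24, 20, 15, 10, 5],
     [6, 9, 12, 18, 15, 12, 8, 4],
     [4, 6, 8, 12, 10, 8, 6, 3],
     [2, 3, 4, 6, 5, 4, 3, 2]] ! (i - 1) ! (j - 1)"

text \<open>Twice the inverse of the symmetrised matrix with diagonal 4, 4, 2, 2, not of the Cartan
  matrix, since root lengths differ.\<close>

definition inverse_F4 :: "nat \<Rightarrow> nat \<Rightarrow> int" where
  "inverse_F4 i j =
    [[2, 3, 4, 2], [3, 6, 8, 4], [4, 8, 12, 6], [2, 4, 6, 4]] ! (i - 1) ! (j - 1)"

text \<open>Three times the inverse of the symmetrised matrix with rows (2, -3) and (-3, 6).\<close>

definition inverse_G2 :: "nat \<Rightarrow> nat \<Rightarrow> int" where
  "inverse_G2 i j =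
    [[6, 3], [3, 2]] ! (i - 1) ! (j - 1)"

context root_system_with_highest
begin

text \<open>The diagram is connected with single bonds only: nodes 3 to l form a path, on which node
  1 hangs at 3 and node 2 at 4.\<close>

lemma type_E_norms:
  assumes basis: "cartan_basis (Type_E l) \<alpha>" and l: "l \<ge> 6" and i: "i \<in> {1..l}"
  shows "\<alpha> i \<bullet> \<alpha> i = \<alpha> l \<bullet> \<alpha> l"
proof -
  note norms = basis_norms[OF basis, simplified]
  have ge3: "\<alpha> i \<bullet> \<alpha> i = \<alpha> l \<bullet> \<alpha> l" if "3 \<le> i" "i \<le> l" for i
  proof (rule constant_on_interval[where a = 3])
    fix i assume "3 \<le> i" "i < l"
    then show "\<alpha> i \<bullet> \<alpha> i = \<alpha> (Suc i) \<bullet> \<alpha> (Suc i)"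
      using norms[of i "Suc i"] by (auto simp: path_entry_def doubleton_eq_iff split: if_splits)
  qed (use that in auto)
  have "\<alpha> 1 \<bullet> \<alpha> 1 = \<alpha> 3 \<bullet> \<alpha> 3" "\<alpha> 2 \<bullet> \<alpha> 2 = \<alpha> 4 \<bullet> \<alpha> 4"
    using norms[of 1 3] norms[of 2 4] l by (simp_all add: doubleton_eq_iff)
  moreover have "i = 1 \<or> i = 2 \<or> 3 \<le> i" using i by auto
  ultimately show ?thesis using ge3[of i] ge3[of 3] ge3[of 4] i l by auto
qed

text \<open>The ratio W_ii / m_i^2 is 4 at the end nodes 1 and 6, where m_i = 1, and at most 5/2
  elsewhere; 2 * 4 / 3 gives the constant.\<close>

lemma root_d_type_E6:
  assumes basis: "cartan_basis (Type_E 6) \<alpha>" and reduced: "reduced_roots \<Phi>"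
  shows "root_d lt \<Phi> \<psi> = sqrt (8 / 3 / (\<psi> \<bullet> \<psi>))"
proof -
  define t where "t = (\<alpha> 6 \<bullet> \<alpha> 6) / 2"
  have t: "t > 0" using basis_pos[OF basis, of 6] by (simp add: t_def)
  have norms: "\<alpha> i \<bullet> \<alpha> i = 2 * t * real_of_int 1" if "i \<in> {1..6}" for i
    using type_E_norms[OF basis _ that] by (simp add: t_def)
  let ?I = "{1..cartan_rank (Type_E 6)}"
  let ?c = "\<lambda>_. 1 :: int" and ?m = "\<lambda>i. [1, 2, 2, 3, 2, 1] ! (i - 1) :: int"
  have I: "{1..6} = ({1, 2, 3, 4, 5, 6} :: nat set)" by auto
  have "root_d lt \<Phi> \<psi> = sqrt (real_of_int (2 * ?c 6 * inverse_E6 1 1)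
      / real_of_int (3 * (?m 1)\<^sup>2) / (\<psi> \<bullet> \<psi>))"
  proof (rule root_d_inverse_cartan[where c = ?c and W = inverse_E6
        and m = ?m and d = 3 and p = 6 and q = 1, OF basis reduced refl refl t])
    show "\<forall>i\<in>?I. \<forall>j\<in>?I.
        (\<Sum>k\<in>?I. inverse_E6 i k * (cartan_matrix (Type_E 6) k j * ?c j))
        = (if i = j then 3 else 0)"
      unfolding inverse_E6_def by code_simp
    show "\<forall>i\<in>?I. inverse_E6 i i * (?m 1)\<^sup>2 \<le> inverse_E6 1 1 * (?m i)\<^sup>2"
      unfolding inverse_E6_def by code_simp
    show "(\<Sum>i\<in>?I. \<Sum>j\<in>?I.
        ?m i * ?m j * (cartan_matrix (Type_E 6) i j * ?c j)) = 2 * ?c 6"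
      by code_simp
    show "\<forall>i\<in>?I. ?m i > 0" by code_simp
    show "\<forall>i\<in>?I. ?c i \<le> ?c 6" by simp
  next
    fix n k :: "nat \<Rightarrow> int"
    assume "\<forall>i\<in>?I. n i \<ge> 1" "\<forall>i\<in>?I. k i \<ge> 0"
      and "\<forall>i\<in>?I. 3 * n i = ?c 6 * (\<Sum>j\<in>?I. inverse_E6 i j * k j)"
    then have n: "n 1 \<ge> 1" "3 * n 1 = ?c 6 * (\<Sum>j\<in>{1..6}. inverse_E6 1 j * k j)"
      and k: "k 1 \<ge> 0" "k 2 \<ge> 0" "k 3 \<ge> 0" "k 4 \<ge> 0" "k 5 \<ge> 0" "k 6 \<ge> 0"
      by auto
    from n(2) have lin: "3 * n 1 = 1 * (4 * k 1 + 3 * k 2 + 5 * k 3 + 6 * k 4 + 4 * k 5 + 2 * k 6)"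
      unfolding I by (simp add: inverse_E6_def)
    have sum: "(\<Sum>i\<in>?I. ?m i * k i) = 1 * k 1 + 2 * k 2 + 2 * k 3 + 3 * k 4 + 2 * k 5 + 1 * k 6"
      unfolding cartan_rank.simps I by simp
    show "(\<Sum>i\<in>?I. ?m i * k i) \<ge> 2"
    proof (rule ccontr)
      assume "\<not> ?thesis"
      then have "1 * k 1 + 2 * k 2 + 2 * k 3 + 3 * k 4 + 2 * k 5 + 1 * k 6 < 2" unfolding sum by linarith
      then have "k 2 = 0" "k 3 = 0" "k 4 = 0" "k 5 = 0" "k 1 + k 6 < 2"
        using k by linarith+
      \<comment> \<open>Only the minuscule weights at nodes 1 and 6, or zero, remain. Then 3 n_1
        would be 4, 2 or 0, so they are excluded by the root lattice or by n_1 \<ge> 1.\<close>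
      then have "k 1 + k 6 < 2" "3 * n 1 = 4 * k 1 + 2 * k 6" using lin by simp_all
      then show False using n(1) k(1,6) by presburger
    qed
  qed (use norms in auto)
  then show ?thesis by (simp add: inverse_E6_def)
qed

text \<open>Node 7 is the only one with m_i = 1, and there W_ii / m_i^2 has its largest value
  3.\<close>

lemma root_d_type_E7:
  assumes basis: "cartan_basis (Type_E 7) \<alpha>" and reduced: "reduced_roots \<Phi>"
  shows "root_d lt \<Phi> \<psi> = sqrt (3 / (\<psi> \<bullet> \<psi>))"
proof -
  define t where "t = (\<alpha> 7 \<bullet> \<alpha> 7) / 2"
  have t: "t > 0" using basis_pos[OF basis, of 7] by (simp add: t_def)
  have norms: "\<alpha> i \<bullet> \<alpha> i = 2 * t * real_of_int 1" if "i \<in> {1..7}" for i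
    using type_E_norms[OF basis _ that] by (simp add: t_def)
  let ?I = "{1..cartan_rank (Type_E 7)}"
  let ?c = "\<lambda>_. 1 :: int" and ?m = "\<lambda>i. [2, 2, 3, 4, 3, 2, 1] ! (i - 1) :: int"
  have I: "{1..7} = ({1, 2, 3, 4, 5, 6, 7} :: nat set)" by auto
  have "root_d lt \<Phi> \<psi> = sqrt (real_of_int (2 * ?c 7 * inverse_E7 7 7)
      / real_of_int (2 * (?m 7)\<^sup>2) / (\<psi> \<bullet> \<psi>))"
  proof (rule root_d_inverse_cartan[where c = ?c and W = inverse_E7
        and m = ?m and d = 2 and p = 7 and q = 7, OF basis reduced refl refl t])
    show "\<forall>i\<in>?I. \<forall>j\<in>?I.
        (\<Sum>k\<in>?I. inverse_E7 i k * (cartan_matrix (Type_E 7) k j * ?c j))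
        = (if i = j then 2 else 0)"
      unfolding inverse_E7_def by code_simp
    show "\<forall>i\<in>?I. inverse_E7 i i * (?m 7)\<^sup>2 \<le> inverse_E7 7 7 * (?m i)\<^sup>2"
      unfolding inverse_E7_def by code_simp
    show "(\<Sum>i\<in>?I. \<Sum>j\<in>?I.
        ?m i * ?m j * (cartan_matrix (Type_E 7) i j * ?c j)) = 2 * ?c 7"
      by code_simp
    show "\<forall>i\<in>?I. ?m i > 0" by code_simp
    show "\<forall>i\<in>?I. ?c i \<le> ?c 7" by simp
  next
    fix n k :: "nat \<Rightarrow> int"
    assume "\<forall>i\<in>?I. n i \<ge> 1" "\<forall>i\<in>?I. k i \<ge> 0"
      and "\<forall>i\<in>?I. 2 * n i = ?c 7 * (\<Sum>j\<in>?I. inverse_E7 i j * k j)"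
    then have n: "n 7 \<ge> 1" "2 * n 7 = ?c 7 * (\<Sum>j\<in>{1..7}. inverse_E7 7 j * k j)"
      and k: "k 1 \<ge> 0" "k 2 \<ge> 0" "k 3 \<ge> 0" "k 4 \<ge> 0" "k 5 \<ge> 0" "k 6 \<ge> 0" "k 7 \<ge> 0"
      by auto
    from n(2) have lin: "2 * n 7 = 1 * (2 * k 1 + 3 * k 2 + 4 * k 3 + 6 * k 4 + 5 * k 5 + 4 * k 6 + 3 * k 7)"
      unfolding I by (simp add: inverse_E7_def)
    have sum: "(\<Sum>i\<in>?I. ?m i * k i) = 2 * k 1 + 2 * k 2 + 3 * k 3 + 4 * k 4 + 3 * k 5 + 2 * k 6 + 1 * k 7"
      unfolding cartan_rank.simps I by simp
    show "(\<Sum>i\<in>?I. ?m i * k i) \<ge> 2"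
    proof (rule ccontr)
      assume "\<not> ?thesis"
      then have "2 * k 1 + 2 * k 2 + 3 * k 3 + 4 * k 4 + 3 * k 5 + 2 * k 6 + 1 * k 7 < 2" unfolding sum by linarith
      then have "k 1 = 0" "k 2 = 0" "k 3 = 0" "k 4 = 0" "k 5 = 0" "k 6 = 0" "k 7 < 2"
        using k by linarith+
      \<comment> \<open>Here k_7 = 1 fails by parity and k_7 = 0 by n_7 \<ge> 1.\<close>
      then have "k 7 < 2" "2 * n 7 = 3 * k 7" using lin by simp_all
      then show False using n(1) k(7) by presburger
    qed
  qed (use norms in auto)
  then show ?thesis by (simp add: inverse_E7_def)
qed

text \<open>Every coefficient of \<theta> is at least 2, so the only possible exception is k = 0,
  which n_1 \<ge> 1 rules out. The ratio W_ii / m_i^2 is largest at node 1, with value 1.\<close>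

lemma root_d_type_E8:
  assumes basis: "cartan_basis (Type_E 8) \<alpha>" and reduced: "reduced_roots \<Phi>"
  shows "root_d lt \<Phi> \<psi> = sqrt (2 / (\<psi> \<bullet> \<psi>))"
proof -
  define t where "t = (\<alpha> 8 \<bullet> \<alpha> 8) / 2"
  have t: "t > 0" using basis_pos[OF basis, of 8] by (simp add: t_def)
  have norms: "\<alpha> i \<bullet> \<alpha> i = 2 * t * real_of_int 1" if "i \<in> {1..8}" for i
    using type_E_norms[OF basis _ that] by (simp add: t_def)
  let ?I = "{1..cartan_rank (Type_E 8)}"
  let ?c = "\<lambda>_. 1 :: int" and ?m = "\<lambda>i. [2, 3, 4, 6, 5, 4, 3, 2] ! (i - 1) :: int"
  have I: "{1..8} = ({1, 2, 3, 4, 5, 6, 7, 8} :: nat set)" by auto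
  have "root_d lt \<Phi> \<psi> = sqrt (real_of_int (2 * ?c 8 * inverse_E8 1 1)
      / real_of_int (1 * (?m 1)\<^sup>2) / (\<psi> \<bullet> \<psi>))"
  proof (rule root_d_inverse_cartan[where c = ?c and W = inverse_E8
        and m = ?m and d = 1 and p = 8 and q = 1, OF basis reduced refl refl t])
    show "\<forall>i\<in>?I. \<forall>j\<in>?I.
        (\<Sum>k\<in>?I. inverse_E8 i k * (cartan_matrix (Type_E 8) k j * ?c j))
        = (if i = j then 1 else 0)"
      unfolding inverse_E8_def by code_simp
    show "\<forall>i\<in>?I. inverse_E8 i i * (?m 1)\<^sup>2 \<le> inverse_E8 1 1 * (?m i)\<^sup>2"
      unfolding inverse_E8_def by code_simp
    show "(\<Sum>i\<in>?I. \<Sum>j\<in>?I.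
        ?m i * ?m j * (cartan_matrix (Type_E 8) i j * ?c j)) = 2 * ?c 8"
      by code_simp
    show "\<forall>i\<in>?I. ?m i > 0" by code_simp
    show "\<forall>i\<in>?I. ?c i \<le> ?c 8" by simp
  next
    fix n k :: "nat \<Rightarrow> int"
    assume "\<forall>i\<in>?I. n i \<ge> 1" "\<forall>i\<in>?I. k i \<ge> 0"
      and "\<forall>i\<in>?I. 1 * n i = ?c 8 * (\<Sum>j\<in>?I. inverse_E8 i j * k j)"
    then have n: "n 1 \<ge> 1" "1 * n 1 = ?c 8 * (\<Sum>j\<in>{1..8}. inverse_E8 1 j * k j)"
      and k: "k 1 \<ge> 0" "k 2 \<ge> 0" "k 3 \<ge> 0" "k 4 \<ge> 0" "k 5 \<ge> 0" "k 6 \<ge> 0" "k 7 \<ge> 0" "k 8 \<ge> 0"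
      by auto
    from n(2) have lin: "1 * n 1 = 1 * (4 * k 1 + 5 * k 2 + 7 * k 3 + 10 * k 4 + 8 * k 5 + 6 * k 6 + 4 * k 7 + 2 * k 8)"
      unfolding I by (simp add: inverse_E8_def)
    have sum: "(\<Sum>i\<in>?I. ?m i * k i) = 2 * k 1 + 3 * k 2 + 4 * k 3 + 6 * k 4 + 5 * k 5 + 4 * k 6 + 3 * k 7 + 2 * k 8"
      unfolding cartan_rank.simps I by simp
    show "(\<Sum>i\<in>?I. ?m i * k i) \<ge> 2"
    proof (rule ccontr)
      assume "\<not> ?thesis"
      then have "2 * k 1 + 3 * k 2 + 4 * k 3 + 6 * k 4 + 5 * k 5 + 4 * k 6 + 3 * k 7 + 2 * k 8 < 2" unfolding sum by linarith
      then have "k 1 = 0" "k 2 = 0" "k 3 = 0" "k 4 = 0" "k 5 = 0" "k 6 = 0" "k 7 = 0" "k 8 = 0"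
        using k by linarith+
      then show False using lin n(1) by simp
    qed
  qed (use norms in auto)
  then show ?thesis by (simp add: inverse_E8_def)
qed

text \<open>The unit \<open>t\<close> is half the squared length of a short root, hence the weights
  2, 2, 1, 1. The ratios W_ii / m_i^2 are 1/2, 2/3, 3/4, 1, so the vertex at the short end
  wins.\<close>

lemma root_d_type_F4:
  assumes basis: "cartan_basis Type_F4 \<alpha>" and reduced: "reduced_roots \<Phi>"
  shows "root_d lt \<Phi> \<psi> = sqrt (2 / (\<psi> \<bullet> \<psi>))"
proof -
  define t where "t = (\<alpha> 4 \<bullet> \<alpha> 4) / 2"
  have t: "t > 0" using basis_pos[OF basis, of 4] by (simp add: t_def)
  note norms' = basis_norms[OF basis, simplified]
  have "\<alpha> 1 \<bullet> \<alpha> 1 = \<alpha> 2 \<bullet> \<alpha> 2" "\<alpha> 2 \<bullet> \<alpha> 2 = 2 * (\<alpha> 3 \<bullet> \<alpha> 3)" "\<alpha> 3 \<bullet> \<alpha> 3 = \<alpha> 4 \<bullet> \<alpha> 4"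
    using norms'[of 1 2] norms'[of 2 3] norms'[of 3 4] by (simp_all add: path_entry_def)
  moreover have "i = 1 \<or> i = 2 \<or> i = 3 \<or> i = 4" if "i \<in> {1..4}" for i :: nat using that by auto
  ultimately have norms: "\<alpha> i \<bullet> \<alpha> i = 2 * t * real_of_int ([2, 2, 1, 1] ! (i - 1))" if "i \<in> {1..4}" for i
    using that by (fastforce simp: t_def)
  let ?I = "{1..cartan_rank Type_F4}"
  let ?c = "\<lambda>i. [2, 2, 1, 1] ! (i - 1) :: int" and ?m = "\<lambda>i. [2, 3, 4, 2] ! (i - 1) :: int"
  have I: "{1..4} = ({1, 2, 3, 4} :: nat set)" by auto
  have "root_d lt \<Phi> \<psi> = sqrt (real_of_int (2 * ?c 1 * inverse_F4 4 4)
      / real_of_int (2 * (?m 4)\<^sup>2) / (\<psi> \<bullet> \<psi>))"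
  proof (rule root_d_inverse_cartan[where c = ?c and W = inverse_F4
        and m = ?m and d = 2 and p = 1 and q = 4, OF basis reduced refl refl t])
    show "\<forall>i\<in>?I. \<forall>j\<in>?I.
        (\<Sum>k\<in>?I. inverse_F4 i k * (cartan_matrix Type_F4 k j * ?c j))
        = (if i = j then 2 else 0)"
      unfolding inverse_F4_def by code_simp
    show "\<forall>i\<in>?I. inverse_F4 i i * (?m 4)\<^sup>2 \<le> inverse_F4 4 4 * (?m i)\<^sup>2"
      unfolding inverse_F4_def by code_simp
    show "(\<Sum>i\<in>?I. \<Sum>j\<in>?I.
        ?m i * ?m j * (cartan_matrix Type_F4 i j * ?c j)) = 2 * ?c 1"
      by code_simp
    show "\<forall>i\<in>?I. ?m i > 0" by code_simp
    show "\<forall>i\<in>?I. ?c i \<le> ?c 1" by code_simp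
  next
    fix n k :: "nat \<Rightarrow> int"
    assume "\<forall>i\<in>?I. n i \<ge> 1" "\<forall>i\<in>?I. k i \<ge> 0"
      and "\<forall>i\<in>?I. 2 * n i = ?c 1 * (\<Sum>j\<in>?I. inverse_F4 i j * k j)"
    then have n: "n 1 \<ge> 1" "2 * n 1 = ?c 1 * (\<Sum>j\<in>{1..4}. inverse_F4 1 j * k j)"
      and k: "k 1 \<ge> 0" "k 2 \<ge> 0" "k 3 \<ge> 0" "k 4 \<ge> 0"
      by auto
    from n(2) have lin: "2 * n 1 = 2 * (2 * k 1 + 3 * k 2 + 4 * k 3 + 2 * k 4)"
      unfolding I by (simp add: inverse_F4_def)
    have sum: "(\<Sum>i\<in>?I. ?m i * k i) = 2 * k 1 + 3 * k 2 + 4 * k 3 + 2 * k 4"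
      unfolding cartan_rank.simps I by simp
    show "(\<Sum>i\<in>?I. ?m i * k i) \<ge> 2"
    proof (rule ccontr)
      assume "\<not> ?thesis"
      then have "2 * k 1 + 3 * k 2 + 4 * k 3 + 2 * k 4 < 2" unfolding sum by linarith
      then have "k 1 = 0" "k 2 = 0" "k 3 = 0" "k 4 = 0"
        using k by linarith+
      then show False using lin n(1) by simp
    qed
  qed (use norms in auto)
  then show ?thesis by (simp add: inverse_F4_def)
qed

text \<open>The vertex at the short root wins with 6/9 against 2/4, and 2 * 3 * 6 / (3 * 9) =
  4/3.\<close>

lemma root_d_type_G2:
  assumes basis: "cartan_basis Type_G2 \<alpha>" and reduced: "reduced_roots \<Phi>"
  shows "root_d lt \<Phi> \<psi> = sqrt (4 / 3 / (\<psi> \<bullet> \<psi>))"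
proof -
  define t where "t = (\<alpha> 1 \<bullet> \<alpha> 1) / 2"
  have t: "t > 0" using basis_pos[OF basis, of 1] by (simp add: t_def)
  have "\<alpha> 2 \<bullet> \<alpha> 2 = 3 * (\<alpha> 1 \<bullet> \<alpha> 1)"
    using basis_norms[OF basis, of 1 2] by (simp add: path_entry_def)
  moreover have "i = 1 \<or> i = 2" if "i \<in> {1..2}" for i :: nat using that by auto
  ultimately have norms: "\<alpha> i \<bullet> \<alpha> i = 2 * t * real_of_int ([1, 3] ! (i - 1))" if "i \<in> {1..2}" for i
    using that by (fastforce simp: t_def)
  let ?I = "{1..cartan_rank Type_G2}"
  let ?c = "\<lambda>i. [1, 3] ! (i - 1) :: int" and ?m = "\<lambda>i. [3, 2] ! (i - 1) :: int"
  have I: "{1..2} = ({1, 2} :: nat set)" by auto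
  have "root_d lt \<Phi> \<psi> = sqrt (real_of_int (2 * ?c 2 * inverse_G2 1 1)
      / real_of_int (3 * (?m 1)\<^sup>2) / (\<psi> \<bullet> \<psi>))"
  proof (rule root_d_inverse_cartan[where c = ?c and W = inverse_G2
        and m = ?m and d = 3 and p = 2 and q = 1, OF basis reduced refl refl t])
    show "\<forall>i\<in>?I. \<forall>j\<in>?I.
        (\<Sum>k\<in>?I. inverse_G2 i k * (cartan_matrix Type_G2 k j * ?c j))
        = (if i = j then 3 else 0)"
      unfolding inverse_G2_def by code_simp
    show "\<forall>i\<in>?I. inverse_G2 i i * (?m 1)\<^sup>2 \<le> inverse_G2 1 1 * (?m i)\<^sup>2"
      unfolding inverse_G2_def by code_simp
    show "(\<Sum>i\<in>?I. \<Sum>j\<in>?I.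
        ?m i * ?m j * (cartan_matrix Type_G2 i j * ?c j)) = 2 * ?c 2"
      by code_simp
    show "\<forall>i\<in>?I. ?m i > 0" by code_simp
    show "\<forall>i\<in>?I. ?c i \<le> ?c 2" by code_simp
  next
    fix n k :: "nat \<Rightarrow> int"
    assume "\<forall>i\<in>?I. n i \<ge> 1" "\<forall>i\<in>?I. k i \<ge> 0"
      and "\<forall>i\<in>?I. 3 * n i = ?c 2 * (\<Sum>j\<in>?I. inverse_G2 i j * k j)"
    then have n: "n 1 \<ge> 1" "3 * n 1 = ?c 2 * (\<Sum>j\<in>{1..2}. inverse_G2 1 j * k j)"
      and k: "k 1 \<ge> 0" "k 2 \<ge> 0"
      by auto
    from n(2) have lin: "3 * n 1 = 3 * (6 * k 1 + 3 * k 2)"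
      unfolding I by (simp add: inverse_G2_def)
    have sum: "(\<Sum>i\<in>?I. ?m i * k i) = 3 * k 1 + 2 * k 2"
      unfolding cartan_rank.simps I by simp
    show "(\<Sum>i\<in>?I. ?m i * k i) \<ge> 2"
    proof (rule ccontr)
      assume "\<not> ?thesis"
      then have "3 * k 1 + 2 * k 2 < 2" unfolding sum by linarith
      then have "k 1 = 0" "k 2 = 0"
        using k by linarith+
      then show False using lin n(1) by simp
    qed
  qed (use norms in auto)
  then show ?thesis by (simp add: inverse_G2_def)
qed

lemma cartan_basis_if_has_type:
  assumes "has_type lt \<Phi> X"
  obtains \<alpha> where "reduced_roots \<Phi>" "cartan_basis X \<alpha>"
  using assms that unfolding has_type_def cartan_basis_def by blast

lemma cartan_basis_if_has_type_BC:
  assumes "has_type_BC lt \<Phi> l"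
  obtains \<alpha> where "\<not> reduced_roots \<Phi>" "cartan_basis (Type_B l) \<alpha>"
proof -
  \<comment> \<open>On the index set {1} the Cartan matrices of A and B in rank 1 agree, so the case
    distinction of \<open>has_type_BC\<close> collapses.\<close>
  have "has_type lt (indivisible_roots \<Phi>) (Type_B l)"
    using assms by (cases "l = 1") (auto simp: has_type_BC_def has_type_def)
  then show ?thesis
    using assms that unfolding has_type_BC_def has_type_def cartan_basis_def simple_roots_indivisible by blast
qed

end

lemma powr_neg_half: "a > 0 \<Longrightarrow> a powr - (1 / 2) = 1 / sqrt (a :: real)"
  using powr_minus_divide[of a "1 / 2"] powr_half_sqrt[of a] by simp

theorem mainTheorem7:
  fixes \<Phi> :: "'a::euclidean_space set"
    and lt :: "'a \<Rightarrow> 'a \<Rightarrow> bool"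
    and \<psi> :: 'a
    and l :: nat
  assumes "root_system \<Phi>"
    and "irreducible_roots \<Phi>"
    and "vector_ordering lt"
    and "highest_root lt \<Phi> \<psi>"
    and "DIM('a) = l"
  shows
    "(\<exists>x\<in>alcove_face lt \<Phi> \<psi>. sqrt (x \<bullet> x) = root_d lt \<Phi> \<psi>) \<and>
     (\<forall>x\<in>alcove_face lt \<Phi> \<psi>. sqrt (x \<bullet> x) \<le> root_d lt \<Phi> \<psi>) \<and>
     (l \<ge> 1 \<and> has_type lt \<Phi> (Type_A l) \<longrightarrow>
        (odd l \<longrightarrow> root_d lt \<Phi> \<psi> = sqrt 2 / 2 * (\<psi> \<bullet> \<psi>) powr (-1/2) * (real l + 1) powr (1/2)) \<and>
        (even l \<longrightarrow> root_d lt \<Phi> \<psi> =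
           sqrt 2 / 2 * (\<psi> \<bullet> \<psi>) powr (-1/2) * (real l * (real l + 2)) powr (1/2) * (real l + 1) powr (-1/2))) \<and>
     (l \<ge> 2 \<and> has_type lt \<Phi> (Type_B l) \<longrightarrow>
        (l \<le> 3 \<longrightarrow> root_d lt \<Phi> \<psi> = sqrt 2 * (\<psi> \<bullet> \<psi>) powr (-1/2)) \<and>
        (l \<ge> 4 \<longrightarrow> root_d lt \<Phi> \<psi> = sqrt 2 / 2 * (\<psi> \<bullet> \<psi>) powr (-1/2) * real l powr (1/2))) \<and>
     (l \<ge> 3 \<and> has_type lt \<Phi> (Type_C l) \<longrightarrow>
        root_d lt \<Phi> \<psi> = (\<psi> \<bullet> \<psi>) powr (-1/2) * real l powr (1/2)) \<and>
     (l \<ge> 4 \<and> has_type lt \<Phi> (Type_D l) \<longrightarrow>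
        root_d lt \<Phi> \<psi> = sqrt 2 / 2 * (\<psi> \<bullet> \<psi>) powr (-1/2) * real l powr (1/2)) \<and>
     (has_type lt \<Phi> (Type_E 6) \<longrightarrow>
        root_d lt \<Phi> \<psi> = 2 * sqrt 6 / 3 * (\<psi> \<bullet> \<psi>) powr (-1/2)) \<and>
     (has_type lt \<Phi> (Type_E 7) \<longrightarrow>
        root_d lt \<Phi> \<psi> = sqrt 3 * (\<psi> \<bullet> \<psi>) powr (-1/2)) \<and>
     (has_type lt \<Phi> (Type_E 8) \<longrightarrow>
        root_d lt \<Phi> \<psi> = sqrt 2 * (\<psi> \<bullet> \<psi>) powr (-1/2)) \<and>
     (has_type lt \<Phi> Type_F4 \<longrightarrow>
        root_d lt \<Phi> \<psi> = sqrt 2 * (\<psi> \<bullet> \<psi>) powr (-1/2)) \<and>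
     (has_type lt \<Phi> Type_G2 \<longrightarrow>
        root_d lt \<Phi> \<psi> = 2 * sqrt 3 / 3 * (\<psi> \<bullet> \<psi>) powr (-1/2)) \<and>
     (l \<ge> 1 \<and> has_type_BC lt \<Phi> l \<longrightarrow>
        root_d lt \<Phi> \<psi> = (\<psi> \<bullet> \<psi>) powr (-1/2) * real l powr (1/2))"
proof -
  interpret root_system_with_highest \<Phi> lt \<psi>
    by unfold_locales (use assms in auto)
  have a: "\<psi> \<bullet> \<psi> > 0" by (rule highest_pos)
  note powr = powr_neg_half[OF a] powr_neg_half[of "real l + 1"] powr_half_sqrt
  have A: "root_d lt \<Phi> \<psi> = sqrt 2 / 2 * (\<psi> \<bullet> \<psi>) powr (-1/2) * (real l + 1) powr (1/2)"
    if l: "l \<ge> 1" "odd l" and type: "has_type lt \<Phi> (Type_A l)"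
  proof -
    obtain \<alpha> where "reduced_roots \<Phi>" "cartan_basis (Type_A l) \<alpha>"
      using cartan_basis_if_has_type[OF type] by blast
    then have "root_d lt \<Phi> \<psi> = sqrt ((real l + 1) / 2 / (\<psi> \<bullet> \<psi>))"
      using root_d_type_A(1) l by blast
    also have "\<dots> = sqrt 2 / 2 * (\<psi> \<bullet> \<psi>) powr (-1/2) * (real l + 1) powr (1/2)"
      using a by (intro real_sqrt_unique) (simp_all add: powr power_mult_distrib power_divide field_simps)
    finally show ?thesis .
  qed
  have A': "root_d lt \<Phi> \<psi> = sqrt 2 / 2 * (\<psi> \<bullet> \<psi>) powr (-1/2) * (real l * (real l + 2)) powr (1/2)
      * (real l + 1) powr (-1/2)"
    if l: "l \<ge> 1" "even l" and type: "has_type lt \<Phi> (Type_A l)"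
  proof -
    obtain \<alpha> where "reduced_roots \<Phi>" "cartan_basis (Type_A l) \<alpha>"
      using cartan_basis_if_has_type[OF type] by blast
    then have "root_d lt \<Phi> \<psi> = sqrt (real l * (real l + 2) / (2 * (real l + 1)) / (\<psi> \<bullet> \<psi>))"
      using root_d_type_A(2) l by blast
    also have "\<dots> = sqrt 2 / 2 * (\<psi> \<bullet> \<psi>) powr (-1/2) * (real l * (real l + 2)) powr (1/2)
      * (real l + 1) powr (-1/2)"
      using a by (intro real_sqrt_unique) (simp_all add: powr power_mult_distrib power_divide)
    finally show ?thesis .
  qed
  have B: "root_d lt \<Phi> \<psi> = sqrt (max 1 (real l / 4) * 2 / (\<psi> \<bullet> \<psi>))"
    if "l \<ge> 2" "has_type lt \<Phi> (Type_B l)"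
    using cartan_basis_if_has_type[OF that(2)] root_d_type_B that(1) by blast
  \<comment> \<open>Each right-hand side is nonnegative and its square is the radicand, for instance
    (2 sqrt 6 / 3)^2 = 8/3 and (2 sqrt 3 / 3)^2 = 4/3.\<close>
  have two: "sqrt (2 / (\<psi> \<bullet> \<psi>)) = sqrt 2 * (\<psi> \<bullet> \<psi>) powr (-1/2)"
    and three: "sqrt (3 / (\<psi> \<bullet> \<psi>)) = sqrt 3 * (\<psi> \<bullet> \<psi>) powr (-1/2)"
    and E6: "sqrt (8 / 3 / (\<psi> \<bullet> \<psi>)) = 2 * sqrt 6 / 3 * (\<psi> \<bullet> \<psi>) powr (-1/2)"
    and G2: "sqrt (4 / 3 / (\<psi> \<bullet> \<psi>)) = 2 * sqrt 3 / 3 * (\<psi> \<bullet> \<psi>) powr (-1/2)"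
    and half: "sqrt (real l / 2 / (\<psi> \<bullet> \<psi>)) = sqrt 2 / 2 * (\<psi> \<bullet> \<psi>) powr (-1/2) * real l powr (1/2)"
    and full: "sqrt (real l / (\<psi> \<bullet> \<psi>)) = (\<psi> \<bullet> \<psi>) powr (-1/2) * real l powr (1/2)"
    using a by (auto intro!: real_sqrt_unique simp: powr power_mult_distrib power_divide)
  have B1: "root_d lt \<Phi> \<psi> = sqrt 2 * (\<psi> \<bullet> \<psi>) powr (-1/2)"
    if "l \<ge> 2" "has_type lt \<Phi> (Type_B l)" "l \<le> 3"
    using B[OF that(1,2)] that(3) two by simp
  have B2: "root_d lt \<Phi> \<psi> = sqrt 2 / 2 * (\<psi> \<bullet> \<psi>) powr (-1/2) * real l powr (1/2)"
    if "l \<ge> 2" "has_type lt \<Phi> (Type_B l)" "l \<ge> 4"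
    using B[OF that(1,2)] that(3) half by simp
  have C: "root_d lt \<Phi> \<psi> = (\<psi> \<bullet> \<psi>) powr (-1/2) * real l powr (1/2)"
    if "l \<ge> 3" "has_type lt \<Phi> (Type_C l)"
    using cartan_basis_if_has_type[OF that(2)] root_d_type_C[of l] that(1) full by fastforce
  have D: "root_d lt \<Phi> \<psi> = sqrt 2 / 2 * (\<psi> \<bullet> \<psi>) powr (-1/2) * real l powr (1/2)"
    if "l \<ge> 4" "has_type lt \<Phi> (Type_D l)"
    using cartan_basis_if_has_type[OF that(2)] root_d_type_D that(1) half by metis
  have BC: "root_d lt \<Phi> \<psi> = (\<psi> \<bullet> \<psi>) powr (-1/2) * real l powr (1/2)"
    if "l \<ge> 1" "has_type_BC lt \<Phi> l"
    using cartan_basis_if_has_type_BC[OF that(2)] root_d_nonreduced that(1) full by metis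
  have E6': "root_d lt \<Phi> \<psi> = 2 * sqrt 6 / 3 * (\<psi> \<bullet> \<psi>) powr (-1/2)" if "has_type lt \<Phi> (Type_E 6)"
    using cartan_basis_if_has_type[OF that] root_d_type_E6 E6 by metis
  have E7': "root_d lt \<Phi> \<psi> = sqrt 3 * (\<psi> \<bullet> \<psi>) powr (-1/2)" if "has_type lt \<Phi> (Type_E 7)"
    using cartan_basis_if_has_type[OF that] root_d_type_E7 three by metis
  have E8': "root_d lt \<Phi> \<psi> = sqrt 2 * (\<psi> \<bullet> \<psi>) powr (-1/2)" if "has_type lt \<Phi> (Type_E 8)"
    using cartan_basis_if_has_type[OF that] root_d_type_E8 two by metis
  have F4': "root_d lt \<Phi> \<psi> = sqrt 2 * (\<psi> \<bullet> \<psi>) powr (-1/2)" if "has_type lt \<Phi> Type_F4"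
    using cartan_basis_if_has_type[OF that] root_d_type_F4 two by metis
  have G2': "root_d lt \<Phi> \<psi> = 2 * sqrt 3 / 3 * (\<psi> \<bullet> \<psi>) powr (-1/2)" if "has_type lt \<Phi> Type_G2"
    using cartan_basis_if_has_type[OF that] root_d_type_G2 G2 by metis
  show ?thesis
    by (intro conjI impI root_d_attained A A' B1 B2 C D E6' E7' E8' F4' G2' BC) simp_all
qed

end
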